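(* Let $K$ be an algebraically closed field of characteristic zero, $R=K[X,Y]$, $\mathfrak{m}=(X,Y)$, $R_{\mathfrak{m}}=K[X,Y]_{(X,Y)}$. Let $m,n$ be positive integers and let $H_{i,j,t,x}$ be a subgroup of $\mathbb{U}_m\times\mathbb{U}_n$ (with $i,j,t,x$ admissible parameters). Let $\nu$ be a rational rank $1$ non discrete valuation of $K(X,Y)$ dominating $R_{\mathfrak{m}}$ whose generating sequence $Q_0=X,\ Q_1=Y,\ Q_2,\dots$ consists of eigenfunctions for $H_{i,j,t,x}$. Then $S^{R_{\mathfrak{m}}}(\nu)$ is finitely generated over the subsemigroup $S^{(A_{i,j,t,x})_{\mathfrak{n}}}(\nu)$ if and only if there exists $N\in\mathbb{Z}_{>0}$ such that $Q_r\in A_{i,j,t,x}$ for all $r\ge N$. Further, if $N\geq 1$ and $Q_N\in A_{i,j,t,x}$, then $Q_M\in A_{i,j,t,x}$ for all $M\ge N$.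
   Context: $\mathbb{N}=\{0,1,2,\dots\}$. Groups. Let $\alpha\in K$ be a primitive $m$-th root of unity, $\beta\in K$ a primitive $n$-th root of unity, $\mathbb{U}_m=\langle\alpha\rangle$, $\mathbb{U}_n=\langle\beta\rangle$. Positive integers $i,j,t,x$ are admissible if $i\mid m$, $j\mid n$, $t\mid \frac{m}{i}$, $t\mid\frac{n}{j}$, $\gcd(x,t)=1$ and $1\le x\le t$. For these, $H_{i,j,t,x}=\{(\alpha^{ai},\beta^{bj}) : a,b\in\mathbb{Z},\ b\equiv ax \pmod t\}$, a subgroup of $\mathbb{U}_m\times\mathbb{U}_n$ (every subgroup has this form). Action. $\mathbb{U}_m\times\mathbb{U}_n$ acts on $R$ by $K$-algebra automorphisms with $(\alpha^p,\beta^q)\cdot X=\alpha^pX$ and $(\alpha^p,\beta^q)\cdot Y=\beta^qY$. Put $A_{i,j,t,x}=R^{H_{i,j,t,x}}$ (ring of invariants) and $\mathfrak{n}=\mathfrak{m}\cap A_{i,j,t,x}$. An element $f\in R$ is an eigenfunction for $H_{i,j,t,x}$ if for every $g\in H_{i,j,t,x}$ there is $\lambda_g\in K$ with $g\cdot f=\lambda_g f$. Valuations. $\nu$ is a valuation of $K(X,Y)$ with value group $\Phi_\nu$; it dominates a local ring if its valuation ring contains that ring and the maximal ideal of the valuation ring contracts to the maximal ideal of the ring. Rational rank $1$ means $\Phi_\nu\otimes\mathbb{Q}\cong\mathbb{Q}$ (so $\Phi_\nu$ is regarded as an ordered subgroup of $\mathbb{Q}$), and non discrete means $\Phi_\nu\not\cong\mathbb{Z}$.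 For a local domain $B\subset K(X,Y)$ dominated by $\nu$, $S^{B}(\nu)=\{\nu(f): 0\ne f\in B\}$. The generating sequence of $\nu$ is the sequence $(Q_l)_{l\ge0}$ in $R$ produced by the algorithm of Cutkosky and Vinh: $Q_0=X$, $Q_1=Y$, $\gamma_l=\nu(Q_l)$; for $l\ge1$, $\overline{m_l}=\min\{q\in\mathbb{Z}_{>0}: q\gamma_l\in \sum_{k=0}^{l-1}\gamma_k\mathbb{Z}\}$, and $Q_{l+1}=Q_l^{\overline{m_l}}-\lambda_l X^{c_0}Y^{c_1}Q_2^{c_2}\cdots Q_{l-1}^{c_{l-1}}$, where $\overline{m_l}\gamma_l=\sum_{k=0}^{l-1}c_k\gamma_k$ is the unique representation with $c_0\in\mathbb{N}$ and $0\le c_k<\overline{m_k}$ for $1\le k\le l-1$, and $\lambda_l\in K\setminus\{0\}$ is the unique element such that $\nu(Q_{l+1})>\overline{m_l}\gamma_l$. It has the following properties: (1) $\gamma_{l+1}>\overline{m_l}\gamma_l$ for $l\ge1$; (2) $Q_l$ ($l\ge1$) is monic in $Y$ of degree $d(l)=\deg_Y Q_l$, with $d(1)=1$ and $d(l)=\prod_{k=1}^{l-1}\overline{m_k}$ for $l\ge2$; (3) every $f\in R$ with $\deg_Y f=d$ has a unique expression $f=\sum_{e=0}^{d} f_e$, $f_e=(\sum_l b_{l,e}X^l)Q_1^{j_1(e)}\cdots Q_r^{j_r(e)}$ with $b_{l,e}\in K$, $0\le j_k(e)<\overline{m_k}$, $\deg_Y(Q_1^{j_1(e)}\cdots Q_r^{j_r(e)})=e$;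 the values of distinct nonzero $f_e$ are distinct, so $\nu(f)=\min_e\nu(f_e)$; (4) $S^{R_{\mathfrak{m}}}(\nu)=\sum_{l\ge0}\gamma_l\mathbb{N}$. Finite generation. A semigroup $S$ is finitely generated over a subsemigroup $T$ if there are finitely many $s_1,\dots,s_k\in S$ with $S=\{s_1,\dots,s_k\}+T$. *)

theory Defs
  imports
    "HOL-Computational_Algebra.Polynomial_Factorial"
    "HOL-Number_Theory.Cong"
    "HOL-Algebra.Free_Abelian_Groups"
begin

section \<open>The polynomial ring\<close>

text \<open>\<open>K[X,Y]\<close> is rendered as \<open>K[X][Y]\<close>: the outer variable is \<open>Y\<close>, so \<open>degree\<close> is the degree in \<open>Y\<close>.\<close>

definition varX :: "'k::field poly poly" where
  "varX = [:[:0, 1:]:]"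

definition varY :: "'k::field poly poly" where
  "varY = [:0, 1:]"

definition ideal_XY :: "'k::field poly poly set" where
  "ideal_XY = {varX * f + varY * g |f g. True}"

section \<open>The groups and their action\<close>

definition primitive_root_unity :: "nat \<Rightarrow> 'k::field \<Rightarrow> bool" where
  "primitive_root_unity m \<alpha> \<longleftrightarrow> 0 < m \<and> \<alpha> ^ m = 1 \<and> (\<forall>k. 0 < k \<and> k < m \<longrightarrow> \<alpha> ^ k \<noteq> 1)"

definition admissible :: "nat \<Rightarrow> nat \<Rightarrow> nat \<Rightarrow> nat \<Rightarrow> nat \<Rightarrow> nat \<Rightarrow> bool" where
  "admissible m n i j t x \<longleftrightarrow>
     0 < i \<and> 0 < j \<and> 0 < t \<and> 0 < x \<and>
     i dvd m \<and> j dvd n \<and> t dvd m div i \<and> t dvd n div j \<and> gcd x t = 1 \<and> 1 \<le> x \<and> x \<le> t"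

definition subgroupH :: "'k::field \<Rightarrow> 'k \<Rightarrow> nat \<Rightarrow> nat \<Rightarrow> nat \<Rightarrow> nat \<Rightarrow> ('k \<times> 'k) set" where
  "subgroupH \<alpha> \<beta> i j t x =
     {(\<alpha> powi (a * int i), \<beta> powi (b * int j)) |a b. [b = a * int x] (mod int t)}"

text \<open>\<open>act g f\<close> is \<open>f(g\<^sub>1 X, g\<^sub>2 Y)\<close>.\<close>

definition act :: "'k::field \<times> 'k \<Rightarrow> 'k poly poly \<Rightarrow> 'k poly poly" where
  "act g f = pcompose (map_poly (\<lambda>p. pcompose p [:0, fst g:]) f) [:0, [:snd g:]:]"

definition invariants :: "('k::field \<times> 'k) set \<Rightarrow> 'k poly poly set" where
  "invariants H = {f. \<forall>g\<in>H. act g f = f}"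

definition eigenfunction :: "('k::field \<times> 'k) set \<Rightarrow> 'k poly poly \<Rightarrow> bool" where
  "eigenfunction H f \<longleftrightarrow> (\<forall>g\<in>H. \<exists>c. act g f = smult [:c:] f)"

section \<open>Local rings inside the function field\<close>

definition localization :: "'r::idom set \<Rightarrow> 'r set \<Rightarrow> 'r fract set" where
  "localization B P = {Fract a s |a s. a \<in> B \<and> s \<in> B - P}"

text \<open>For a local ring the nonunits form its maximal ideal.\<close>

definition nonunits :: "'f::comm_ring_1 set \<Rightarrow> 'f set" where
  "nonunits B = {f \<in> B. \<not> (\<exists>g\<in>B. f * g = 1)}"

section \<open>Valuations\<close>

text \<open>The value of a valuation at \<open>0\<close> (mathematically \<open>\<infinity>\<close>) is unspecified; all notions below
  exclude \<open>0\<close> or treat it separately.\<close>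

definition valuation :: "('f::field \<Rightarrow> 'g::linordered_ab_group_add) \<Rightarrow> bool" where
  "valuation \<nu> \<longleftrightarrow>
     (\<forall>f g. f \<noteq> 0 \<longrightarrow> g \<noteq> 0 \<longrightarrow> \<nu> (f * g) = \<nu> f + \<nu> g) \<and>
     (\<forall>f g. f \<noteq> 0 \<longrightarrow> g \<noteq> 0 \<longrightarrow> f + g \<noteq> 0 \<longrightarrow> min (\<nu> f) (\<nu> g) \<le> \<nu> (f + g))"

definition value_group :: "('f::field \<Rightarrow> 'g::linordered_ab_group_add) \<Rightarrow> 'g set" where
  "value_group \<nu> = \<nu> ` (- {0})"

definition valuation_ring :: "('f::field \<Rightarrow> 'g::linordered_ab_group_add) \<Rightarrow> 'f set" where
  "valuation_ring \<nu> = {f. f = 0 \<or> 0 \<le> \<nu> f}"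

definition dominates :: "('f::field \<Rightarrow> 'g::linordered_ab_group_add) \<Rightarrow> 'f set \<Rightarrow> bool" where
  "dominates \<nu> B \<longleftrightarrow>
     B \<subseteq> valuation_ring \<nu> \<and> nonunits (valuation_ring \<nu>) \<inter> B = nonunits B"

definition value_semigroup ::
  "('f::field \<Rightarrow> 'g::linordered_ab_group_add) \<Rightarrow> 'f set \<Rightarrow> 'g set" where
  "value_semigroup \<nu> B = \<nu> ` (B - {0})"

definition finitely_generated_over :: "'g::ab_group_add set \<Rightarrow> 'g set \<Rightarrow> bool" where
  "finitely_generated_over S T \<longleftrightarrow> (\<exists>F. finite F \<and> F \<subseteq> S \<and> S = {s + u |s u. s \<in> F \<and> u \<in> T})"

definition additive_group_on :: "'g::ab_group_add set \<Rightarrow> 'g monoid" where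
  "additive_group_on A = \<lparr>carrier = A, monoid.mult = (+), one = 0\<rparr>"

text \<open>\<open>\<Phi> \<otimes> \<rat>\<close> over the integers: the free abelian group on \<open>\<Phi> \<times> \<rat>\<close> modulo the bilinearity relations.\<close>

definition tensor_relations :: "'g::ab_group_add set \<Rightarrow> (('g \<times> rat) \<Rightarrow>\<^sub>0 int) set" where
  "tensor_relations \<Phi> =
     {frag_of (a + b, q) - frag_of (a, q) - frag_of (b, q) |a b q. a \<in> \<Phi> \<and> b \<in> \<Phi>} \<union>
     {frag_of (a, q + r) - frag_of (a, q) - frag_of (a, r) |a q r. a \<in> \<Phi>}"

definition tensor_rat :: "'g::ab_group_add set \<Rightarrow> (('g \<times> rat) \<Rightarrow>\<^sub>0 int) set monoid" where
  "tensor_rat \<Phi> =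
     free_Abelian_group (\<Phi> \<times> UNIV) Mod
       generate (free_Abelian_group (\<Phi> \<times> UNIV)) (tensor_relations \<Phi>)"

text \<open>A group isomorphism \<open>\<Phi> \<otimes> \<rat> \<cong> \<rat>\<close> is automatically \<open>\<rat>\<close>-linear.\<close>

definition rational_rank_one :: "('f::field \<Rightarrow> 'g::linordered_ab_group_add) \<Rightarrow> bool" where
  "rational_rank_one \<nu> \<longleftrightarrow> tensor_rat (value_group \<nu>) \<cong> additive_group_on (UNIV :: rat set)"

definition non_discrete :: "('f::field \<Rightarrow> 'g::linordered_ab_group_add) \<Rightarrow> bool" where
  "non_discrete \<nu> \<longleftrightarrow> \<not> additive_group_on (value_group \<nu>) \<cong> integer_group"

section \<open>Generating sequences\<close>

definition zmult :: "int \<Rightarrow> 'g::ab_group_add \<Rightarrow> 'g" where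
  "zmult z a = a [^]\<^bsub>additive_group_on UNIV\<^esub> z"

definition gen_value ::
  "('k::field poly poly fract \<Rightarrow> 'g::linordered_ab_group_add) \<Rightarrow> (nat \<Rightarrow> 'k poly poly) \<Rightarrow> nat \<Rightarrow> 'g" where
  "gen_value \<nu> Q l = \<nu> (to_fract (Q l))"

definition mbar ::
  "('k::field poly poly fract \<Rightarrow> 'g::linordered_ab_group_add) \<Rightarrow> (nat \<Rightarrow> 'k poly poly) \<Rightarrow> nat \<Rightarrow> nat" where
  "mbar \<nu> Q l =
     (LEAST q. 0 < q \<and>
        zmult (int q) (gen_value \<nu> Q l) \<in> {\<Sum>k<l. zmult (z k) (gen_value \<nu> Q k) |z. True})"

text \<open>The exponents \<open>c\<close> and the scalar \<open>\<mu>\<close> below are uniquely determined by the stated conditions,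
  so this predicate describes one sequence.\<close>

definition generating_sequence ::
  "('k::field poly poly fract \<Rightarrow> 'g::linordered_ab_group_add) \<Rightarrow> (nat \<Rightarrow> 'k poly poly) \<Rightarrow> bool" where
  "generating_sequence \<nu> Q \<longleftrightarrow>
     Q 0 = varX \<and> Q 1 = varY \<and>
     (\<forall>l\<ge>1. \<exists>(c :: nat \<Rightarrow> nat) \<mu>.
        (\<forall>k. 1 \<le> k \<and> k < l \<longrightarrow> c k < mbar \<nu> Q k) \<and>
        zmult (int (mbar \<nu> Q l)) (gen_value \<nu> Q l) = (\<Sum>k<l. zmult (int (c k)) (gen_value \<nu> Q k)) \<and>
        \<mu> \<noteq> 0 \<and>
        Q (Suc l) = Q l ^ mbar \<nu> Q l - smult [:\<mu>:] (\<Prod>k<l. Q k ^ c k) \<and>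
        gen_value \<nu> Q (Suc l) > zmult (int (mbar \<nu> Q l)) (gen_value \<nu> Q l))"

end

(* A valuation of rational rank one embeds its value group in the rationals, so all values may
   be taken rational. Expanding f in the key polynomials Q_l, the nonzero terms have distinct
   values, hence every f has an initial form c * Q_0^e_0 * ... * Q_(L-1)^e_(L-1) of the same value,
   and the group action preserves values because each Q_l is an eigenfunction.
   Comparing leading coefficients in Y, the character of Q_l (l >= 1) is the power d(l) of the
   character of Y, where d(l) = deg_Y Q_l; as d(l) divides d(l+1), invariance of Q_l persists.
   If S^R = F + S^A with F finite, take L large with mbar_L > 1 (non discreteness provides it)
   and write nu(Q_L) = s + nu(a) with a invariant and s in the group generated by the smaller
   nu(Q_k). Minimality of mbar_L forces s = 0 and a = c Q_L + higher order terms, and then the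
   character of Q_L is that of a, i.e. trivial. Conversely, if Q_r is invariant for r >= N, the
   exponents of Q_0, ..., Q_(N-1) only matter modulo m n, which leaves finitely many. *)

theory Submission
  imports Defs
begin

section \<open>The torus action\<close>

text \<open>The hypotheses give \<open>Q (Suc l)\<close> only through some exponents and a scalar,
  and \<open>mbar\<close> only as a \<open>LEAST\<close>; degrees, monicity and distinctness of
  values all have to be derived from this. A circle must be broken on the way: the least multiple
  exists because any two values are commensurable, which presupposes nonzero \<open>Q k\<close>,
  while nonvanishing follows from a degree count that presupposes positive multiples.
  \<open>key_polynomials_monic\<close> therefore assumes positivity at \<open>l\<close> only on
  condition that all \<open>Q k\<close> with \<open>k \<le> l\<close> are nonzero. To read off the
  character of Q_L from an invariant a = c Q_L + h, one applies g to h. Then g h and \<chi> h, with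
  \<chi> the eigenvalue of Q_L, must both have value above that of a, so the action must not lower
  values on arbitrary polynomials. This is why value preservation is carried through the induction
  of \<open>initial_form\<close>. Non discreteness is used as the absence of a common denominator of
  all values. It yields unbounded degrees d(l), so that every polynomial is reached by
  \<open>initial_form\<close> at some level.\<close>

lemma coeff_act:
  "coeff (coeff (act g f) b) a = fst g ^ a * snd g ^ b * coeff (coeff f b) a"
  by (simp add: act_def coeff_pcompose_linear coeff_map_poly poly_const_pow)

lemma coeff_act': "coeff (act g f) b = smult (snd g ^ b) (pcompose (coeff f b) [:0, fst g:])"
  by (rule poly_eqI) (simp add: coeff_act coeff_pcompose_linear)

lemma act_add: "act g (p + q) = act g p + act g q"
  by (intro poly_eqI) (simp add: coeff_act algebra_simps)

lemma act_diff: "act g (p - q) = act g p - act g q"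
  by (intro poly_eqI) (simp add: coeff_act algebra_simps)

lemma smult_sum_right: "smult c (\<Sum>i\<in>I. p i) = (\<Sum>i\<in>I. smult c (p i))"
  by (induction I rule: infinite_finite_induct) (simp_all add: smult_add_right)

lemma act_mult: "act g (p * q) = act g p * act g q"
proof (rule poly_eqI)
  fix b
  have "coeff (act g (p * q)) b
      = (\<Sum>i\<le>b. smult (snd g ^ b) (pcompose (coeff p i) [:0, fst g:] * pcompose (coeff q (b - i)) [:0, fst g:]))"
    by (simp add: coeff_act' coeff_mult pcompose_sum pcompose_mult smult_sum_right)
  also have "\<dots> = coeff (act g p * act g q) b"
    unfolding coeff_mult
  proof (rule sum.cong[OF refl])
    fix i assume "i \<in> {..b}"
    then have "snd g ^ b = snd g ^ i * snd g ^ (b - i)"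
      by (simp flip: power_add)
    then show "smult (snd g ^ b) (pcompose (coeff p i) [:0, fst g:] * pcompose (coeff q (b - i)) [:0, fst g:])
        = coeff (act g p) i * coeff (act g q) (b - i)"
      by (simp add: coeff_act' mult.commute)
  qed
  finally show "coeff (act g (p * q)) b = coeff (act g p * act g q) b" .
qed

lemma act_const [simp]: "act g [:[:c:]:] = [:[:c:]:]"
  by (intro poly_eqI) (simp add: coeff_act coeff_pCons split: nat.splits)

lemma act_0 [simp]: "act g 0 = 0" and act_1 [simp]: "act g 1 = 1"
  using act_const[of g 0] act_const[of g 1] by (simp_all add: one_pCons)

lemma act_smult: "act g (smult [:c:] f) = smult [:c:] (act g f)"
  by (intro poly_eqI) (simp add: coeff_act algebra_simps)

lemma act_power: "act g (p ^ k) = act g p ^ k"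
  by (induction k) (simp_all add: act_mult)

lemma act_sum: "act g (\<Sum>i\<in>I. p i) = (\<Sum>i\<in>I. act g (p i))"
  by (induction I rule: infinite_finite_induct) (simp_all add: act_add)

lemma act_prod: "act g (\<Prod>i\<in>I. p i) = (\<Prod>i\<in>I. act g (p i))"
  by (induction I rule: infinite_finite_induct) (simp_all add: act_mult)

lemma act_varX: "act g varX = smult [:fst g:] varX"
  by (intro poly_eqI) (simp add: coeff_act varX_def coeff_pCons split: nat.splits)

lemma act_eq_0_iff:
  assumes "fst g \<noteq> 0" "snd g \<noteq> 0"
  shows "act g f = 0 \<longleftrightarrow> f = 0"
  using assms by (auto simp: poly_eq_iff coeff_act)

text \<open>The top coefficient in Y is the constant 1, so it lies in X-degree 0 and the X-part of
  the character cannot appear.\<close>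

lemma eigenvalue_monic:
  assumes "act g f = smult [:c:] f" "lead_coeff f = 1"
  shows "c = snd g ^ degree f"
proof -
  have "coeff (coeff (act g f) (degree f)) 0 = c"
    using assms by simp
  then show ?thesis using assms(2) by (simp add: coeff_act)
qed

text \<open>Repeated division by \<open>q\<close> produces the digits \<open>h s\<close>. The
  coefficients form only a domain (later K[X]), but pseudo-division by a polynomial with leading
  coefficient 1 is genuine division with remainder.\<close>

lemma monic_base_expansion:
  fixes q :: "'a::idom poly"
  assumes "lead_coeff q = 1" "0 < degree q" "degree f < N * degree q"
  shows "\<exists>h. f = (\<Sum>s<N. h s * q ^ s) \<and> (\<forall>s<N. degree (h s) < degree q)"
  using assms(3)
proof (induction N arbitrary: f)
  case 0
  then show ?case by simp
next
  case (Suc N)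
  obtain u r where ur: "pseudo_divmod f q = (u, r)" by fastforce
  have q0: "q \<noteq> 0" using assms by auto
  have f: "f = q * u + r" using pseudo_divmod(1)[OF q0 ur] assms(1) by simp
  have r: "degree r < degree q" using pseudo_divmod(2)[OF q0 ur] assms(2) by auto
  show ?case
  proof (cases "u = 0")
    case True
    then have "f = (\<Sum>s<Suc N. (if s = 0 then r else 0) * q ^ s)"
      using f by (simp add: sum.lessThan_Suc_shift del: sum.lessThan_Suc)
    with r assms(2) show ?thesis by (intro exI[of _ "\<lambda>s. if s = 0 then r else 0"]) auto
  next
    case False
    have "degree f = degree q + degree u"
      using f r False q0 by (metis degree_add_eq_left degree_mult_eq trans_less_add1)
    then have "degree u < N * degree q" using Suc.prems by simp
    from Suc.IH[OF this] obtain h where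
      h: "u = (\<Sum>s<N. h s * q ^ s)" "\<forall>s<N. degree (h s) < degree q" by blast
    define h' where "h' s = (case s of 0 \<Rightarrow> r | Suc s \<Rightarrow> h s)" for s
    have "(\<Sum>s<Suc N. h' s * q ^ s) = r + q * u"
      by (simp add: sum.lessThan_Suc_shift h'_def h(1) sum_distrib_left mult_ac del: sum.lessThan_Suc)
    moreover have "\<forall>s<Suc N. degree (h' s) < degree q"
      using h(2) r by (auto simp: h'_def split: nat.splits)
    ultimately show ?thesis using f by (metis add.commute)
  qed
qed

section \<open>Valuations with rational values\<close>

locale rational_valuation =
  fixes w :: "'k::field poly poly \<Rightarrow> rat"
  assumes w_mult: "f \<noteq> 0 \<Longrightarrow> g \<noteq> 0 \<Longrightarrow> w (f * g) = w f + w g"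
    and w_add: "f \<noteq> 0 \<Longrightarrow> g \<noteq> 0 \<Longrightarrow> f + g \<noteq> 0 \<Longrightarrow> min (w f) (w g) \<le> w (f + g)"
    and w_const: "c \<noteq> 0 \<Longrightarrow> w [:[:c:]:] = 0"
begin

text \<open>Strict inequality of values with 0 counted as having value infinity, since
  \<open>w 0\<close> itself is unspecified.\<close>

definition above :: "rat \<Rightarrow> 'k poly poly \<Rightarrow> bool" where
  "above r f \<longleftrightarrow> f = 0 \<or> r < w f"

lemma w_1 [simp]: "w 1 = 0"
  using w_const[of 1] by (simp add: one_pCons)

lemma w_smult: "c \<noteq> 0 \<Longrightarrow> f \<noteq> 0 \<Longrightarrow> w (smult [:c:] f) = w f"
  using w_mult[of "[:[:c:]:]" f] by (simp add: w_const)

lemma w_uminus: "f \<noteq> 0 \<Longrightarrow> w (- f) = w f"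
proof -
  assume "f \<noteq> 0"
  have "[:- 1:] = - (1 :: 'k poly)" by (simp add: one_pCons)
  then show ?thesis using w_smult[of "-1" f] \<open>f \<noteq> 0\<close> by simp
qed

lemma w_power: "f \<noteq> 0 \<Longrightarrow> w (f ^ k) = of_nat k * w f"
  by (induction k) (simp_all add: w_mult algebra_simps)

lemma w_prod:
  "finite I \<Longrightarrow> (\<And>i. i \<in> I \<Longrightarrow> f i \<noteq> 0) \<Longrightarrow> w (\<Prod>i\<in>I. f i) = (\<Sum>i\<in>I. w (f i))"
  by (induction I rule: finite_induct) (simp_all add: w_mult)

lemma above_0 [simp]: "above r 0"
  by (simp add: above_def)

lemma above_add: "above r f \<Longrightarrow> above r g \<Longrightarrow> above r (f + g)"
  using w_add[of f g] unfolding above_def by (cases "f = 0"; cases "g = 0") force+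

lemma above_uminus: "above r f \<Longrightarrow> above r (- f)"
  using w_uminus[of f] by (cases "f = 0") (auto simp: above_def)

lemma above_diff: "above r f \<Longrightarrow> above r g \<Longrightarrow> above r (f - g)"
  using above_add[of r f "- g"] above_uminus[of r g] by simp

lemma above_smult: "above r f \<Longrightarrow> above r (smult [:c:] f)"
  using w_smult[of c f] by (cases "c = 0"; cases "f = 0") (auto simp: above_def)

lemma above_sum: "(\<And>i. i \<in> I \<Longrightarrow> above r (f i)) \<Longrightarrow> above r (\<Sum>i\<in>I. f i)"
  by (induction I rule: infinite_finite_induct) (simp_all add: above_add)

lemma above_mult: "above r f \<Longrightarrow> g \<noteq> 0 \<Longrightarrow> above (r + w g) (f * g)"
  by (cases "f = 0") (auto simp: above_def w_mult)

text \<open>The upper bound for \<open>w (f + h)\<close> comes from the ultrametric inequality for f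
  = (f + h) + (- h). If f + h vanished, h = - f would have the same value as f.\<close>

lemma w_add_above:
  assumes "f \<noteq> 0" "above (w f) h"
  shows "f + h \<noteq> 0" "w (f + h) = w f"
proof -
  show nz: "f + h \<noteq> 0"
  proof
    assume "f + h = 0"
    then have "h = - f" by (simp add: eq_neg_iff_add_eq_0 add.commute)
    then show False using assms w_uminus[of f] by (simp add: above_def)
  qed
  show "w (f + h) = w f"
  proof (cases "h = 0")
    case False
    then have h: "w f < w h" using assms by (simp add: above_def)
    have "min (w f) (w h) \<le> w (f + h)" using w_add assms(1) False nz by blast
    moreover have "min (w (f + h)) (w (- h)) \<le> w (f + h + - h)"
      using w_add[of "f + h" "- h"] assms(1) False nz by simp
    ultimately show ?thesis using h False by (simp add: w_uminus min_def split: if_splits)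
  qed simp
qed

lemma dominant_term:
  assumes "finite S" "s \<in> S" "F s \<noteq> 0" "\<And>i. i \<in> S \<Longrightarrow> i \<noteq> s \<Longrightarrow> above (w (F s)) (F i)"
  shows "above (w (F s)) ((\<Sum>i\<in>S. F i) - F s)" "(\<Sum>i\<in>S. F i) \<noteq> 0" "w (\<Sum>i\<in>S. F i) = w (F s)"
proof -
  have e: "(\<Sum>i\<in>S. F i) = F s + (\<Sum>i\<in>S - {s}. F i)"
    using assms by (simp add: sum.remove)
  have a: "above (w (F s)) (\<Sum>i\<in>S - {s}. F i)"
    using assms(4) by (intro above_sum) auto
  show "above (w (F s)) ((\<Sum>i\<in>S. F i) - F s)" using a e by simp
  show "(\<Sum>i\<in>S. F i) \<noteq> 0" "w (\<Sum>i\<in>S. F i) = w (F s)"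
    using w_add_above[OF assms(3) a] e by simp_all
qed

end

section \<open>Initial forms along a generating sequence\<close>

text \<open>The \<open>c k\<close> are digits in the mixed radix system with place values
  \<open>D k\<close>, and a number with digits below place L is smaller than \<open>D L\<close>. It
  shows that the monomial subtracted in the construction of \<open>Q (Suc l)\<close> has Y-degree
  below that of \<open>Q l\<close>.\<close>

lemma mixed_radix_bound:
  fixes c :: "nat \<Rightarrow> nat"
  assumes "1 \<le> L" "D 1 = 1" "\<And>l. 1 \<le> l \<Longrightarrow> l < L \<Longrightarrow> D (Suc l) = mb l * D l"
    and "\<And>k. 1 \<le> k \<Longrightarrow> k < L \<Longrightarrow> c k < mb k"
  shows "(\<Sum>k\<in>{1..<L}. c k * D k) < D L"
  using assms
proof (induction L rule: nat_induct_at_least)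
  case base
  then show ?case by simp
next
  case (Suc L)
  have "(\<Sum>k\<in>{1..<Suc L}. c k * D k) < D L + c L * D L"
    using Suc by simp
  also have "\<dots> = Suc (c L) * D L" by simp
  also have "\<dots> \<le> mb L * D L" using Suc(1) Suc.prems(3)[of L] by (intro mult_right_mono) auto
  finally show ?case using Suc by simp
qed

text \<open>The subtracted monomial has too small a Y-degree to touch the leading term of
  \<open>Q l ^ mb l\<close>. The induction carries nonvanishing of the earlier polynomials along,
  because \<open>mb_pos\<close> can be invoked only once it is known.\<close>

lemma key_polynomials_monic:
  fixes Q :: "nat \<Rightarrow> 'k::field poly poly" and mb :: "nat \<Rightarrow> nat"
  defines "d \<equiv> \<lambda>l. degree (Q l)"
  assumes mb_pos: "\<And>l. 1 \<le> l \<Longrightarrow> (\<And>k. k \<le> l \<Longrightarrow> Q k \<noteq> 0) \<Longrightarrow> 0 < mb l"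
    and Q_0: "Q 0 = varX" and Q_1: "Q 1 = varY"
    and Q_step: "\<And>l. 1 \<le> l \<Longrightarrow> \<exists>(c :: nat \<Rightarrow> nat) \<mu>. (\<forall>k. 1 \<le> k \<and> k < l \<longrightarrow> c k < mb k) \<and>
        \<mu> \<noteq> 0 \<and> Q (Suc l) = Q l ^ mb l - smult [:\<mu>:] (\<Prod>k<l. Q k ^ c k)"
    and "1 \<le> l"
  shows "lead_coeff (Q l) = 1 \<and> 1 \<le> d l \<and> d (Suc l) = mb l * d l"
proof -
  have "lead_coeff (Q l) = 1 \<and> d l \<ge> 1 \<and> (\<forall>k. 1 \<le> k \<and> k < l \<longrightarrow> d (Suc k) = mb k * d k) \<and>
     (\<forall>k. 1 \<le> k \<and> k < l \<longrightarrow> Q k \<noteq> 0)"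
    if "1 \<le> l" for l
    using that
  proof (induction l rule: nat_induct_at_least)
    case base
    then show ?case by (simp add: d_def Q_1[simplified] varY_def)
  next
    case (Suc l)
    obtain c \<mu> where c: "\<forall>k. 1 \<le> k \<and> k < l \<longrightarrow> c k < mb k" "\<mu> \<noteq> 0"
      "Q (Suc l) = Q l ^ mb l - smult [:\<mu>:] (\<Prod>k<l. Q k ^ c k)"
      using Q_step[OF Suc(1)] by blast
    have nz: "Q l \<noteq> 0" using Suc by auto
    have nzk: "Q k \<noteq> 0" if "k \<le> l" for k
    proof (cases "k = 0 \<or> k = l")
      case False
      then show ?thesis using that Suc.IH by auto
    qed (use nz Q_0 in \<open>auto simp: varX_def\<close>)
    note mb_l = mb_pos[OF Suc(1) nzk]
    have deg: "degree (Q l ^ mb l) = mb l * d l"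
      using nz by (simp add: degree_power_eq d_def)
    have "degree (\<Prod>k<l. Q k ^ c k) = (\<Sum>k<l. c k * d k)"
    proof (subst degree_prod_eq_sum_degree)
      show "\<forall>k\<in>{..<l}. Q k ^ c k \<noteq> 0" using nzk by simp
      show "(\<Sum>k<l. degree (Q k ^ c k)) = (\<Sum>k<l. c k * d k)"
        using nzk by (simp add: degree_power_eq d_def)
    qed
    also have "\<dots> = (\<Sum>k\<in>{1..<l}. c k * d k)"
    proof (rule sum.mono_neutral_right)
      show "\<forall>k\<in>{..<l} - {1..<l}. c k * d k = 0"
        by (auto simp: d_def Q_0 varX_def not_le less_Suc_eq_0_disj)
    qed auto
    also have "\<dots> < d l"
      using Suc c(1) by (intro mixed_radix_bound) (auto simp: d_def Q_1[simplified] varY_def)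
    also have "\<dots> \<le> mb l * d l" using mb_l by simp
    finally have less: "degree (smult [:\<mu>:] (\<Prod>k<l. Q k ^ c k)) < degree (Q l ^ mb l)"
      using c(2) deg by simp
    have dS: "d (Suc l) = mb l * d l"
      using degree_add_eq_left[of "- smult [:\<mu>:] (\<Prod>k<l. Q k ^ c k)" "Q l ^ mb l"] less deg c(3)
      by (simp add: d_def del: degree_smult_eq)
    have "lead_coeff (Q (Suc l)) = coeff (Q l ^ mb l) (degree (Q l ^ mb l))
        - coeff (smult [:\<mu>:] (\<Prod>k<l. Q k ^ c k)) (degree (Q l ^ mb l))"
      using dS deg by (simp add: d_def c(3))
    also have "\<dots> = 1" using coeff_eq_0[OF less] Suc.IH by (simp add: lead_coeff_power del: coeff_smult)
    finally have "lead_coeff (Q (Suc l)) = 1" .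
    moreover have "1 \<le> d (Suc l)" using dS mb_l Suc.IH by simp
    moreover have "d (Suc k) = mb k * d k \<and> Q k \<noteq> 0" if "1 \<le> k" "k < Suc l" for k
      using that Suc.IH dS nz by (cases "k = l") auto
    ultimately show ?case by blast
  qed
  from this[of l] this[of "Suc l"] \<open>1 \<le> l\<close> show ?thesis by auto
qed

text \<open>The setting after the value group has been embedded in the rationals.
  \<open>mb_least\<close> excludes integer combinations, not only natural ones, because it is
  applied to differences of exponents; \<open>dense\<close> is non discreteness: no positive
  \<open>D\<close> clears the denominators of all values of polynomials.\<close>

locale rational_generating_sequence = rational_valuation w
  for w :: "'k::field poly poly \<Rightarrow> rat" +
  fixes Q :: "nat \<Rightarrow> 'k poly poly" and mb :: "nat \<Rightarrow> nat"
  assumes w_nonneg: "f \<noteq> 0 \<Longrightarrow> 0 \<le> w f"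
    and w_varX: "0 < w varX" and w_varY: "0 < w varY"
    and mb_pos: "1 \<le> l \<Longrightarrow> 0 < mb l"
    and mb_least: "1 \<le> l \<Longrightarrow> 0 < q \<Longrightarrow> q < mb l \<Longrightarrow>
      of_nat q * w (Q l) \<noteq> (\<Sum>k<l. of_int (z k) * w (Q k))"
    and Q_0: "Q 0 = varX" and Q_1: "Q 1 = varY"
    and Q_step: "1 \<le> l \<Longrightarrow> \<exists>(c :: nat \<Rightarrow> nat) \<mu>. (\<forall>k. 1 \<le> k \<and> k < l \<longrightarrow> c k < mb k) \<and>
        of_nat (mb l) * w (Q l) = (\<Sum>k<l. of_nat (c k) * w (Q k)) \<and> \<mu> \<noteq> 0 \<and>
        Q (Suc l) = Q l ^ mb l - smult [:\<mu>:] (\<Prod>k<l. Q k ^ c k) \<and>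
        of_nat (mb l) * w (Q l) < w (Q (Suc l))"
    and dense: "0 < D \<Longrightarrow> \<exists>f. f \<noteq> 0 \<and> of_nat D * w f \<notin> \<int>"
begin

definition d :: "nat \<Rightarrow> nat" where
  "d l = degree (Q l)"

lemma Q_monic_degree: "1 \<le> l \<Longrightarrow> lead_coeff (Q l) = 1 \<and> 1 \<le> d l \<and> d (Suc l) = mb l * d l"
  using key_polynomials_monic[of Q mb l] mb_pos Q_0 Q_1 Q_step unfolding d_def by blast

lemma Q_nz: "Q l \<noteq> 0"
  using Q_monic_degree[of l] by (cases "l = 0") (auto simp: Q_0 varX_def)

lemma d_pos: "1 \<le> l \<Longrightarrow> 0 < d l"
  using Q_monic_degree[of l] by simp

lemma d_1: "d 1 = 1"
  by (simp add: d_def Q_1[simplified] varY_def)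

lemma d_Suc: "1 \<le> l \<Longrightarrow> d (Suc l) = mb l * d l"
  using Q_monic_degree[of l] by simp

lemma lead_coeff_Q: "1 \<le> l \<Longrightarrow> lead_coeff (Q l) = 1"
  using Q_monic_degree[of l] by simp

lemma d_dvd: "1 \<le> l \<Longrightarrow> l \<le> k \<Longrightarrow> d l dvd d k"
proof (induction k)
  case (Suc k)
  then show ?case by (cases "l = Suc k") (auto simp: d_Suc)
qed simp

lemma d_mono: "1 \<le> l \<Longrightarrow> l \<le> k \<Longrightarrow> d l \<le> d k"
  using d_dvd[of l k] d_pos[of k] by (simp add: dvd_imp_le)

lemma w_Q_Suc: "1 \<le> l \<Longrightarrow> w (Q l) < w (Q (Suc l))"
proof -
  assume l: "1 \<le> l"
  have "1 * w (Q l) \<le> of_nat (mb l) * w (Q l)"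
    using mb_pos[OF l] w_nonneg[OF Q_nz] by (intro mult_right_mono) auto
  with Q_step[OF l] show ?thesis by auto
qed

lemma w_Q_strict_mono: "1 \<le> l \<Longrightarrow> l < k \<Longrightarrow> w (Q l) < w (Q k)"
proof (induction k)
  case (Suc k)
  then show ?case using w_Q_Suc[of k] by (cases "l = k") auto
qed simp

lemma w_Q_pos: "0 < w (Q l)"
proof (cases "l \<le> 1")
  case True
  then show ?thesis using w_varX w_varY Q_0 Q_1 by (cases l) auto
next
  case False
  then show ?thesis using w_Q_strict_mono[of 1 l] w_varY Q_1 by simp
qed

definition key_monomial :: "nat \<Rightarrow> (nat \<Rightarrow> nat) \<Rightarrow> 'k poly poly" where
  "key_monomial L e = (\<Prod>k<L. Q k ^ e k)"

lemma key_monomial_nonzero: "key_monomial L e \<noteq> 0"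
  by (simp add: key_monomial_def Q_nz)

lemma w_key_monomial: "w (key_monomial L e) = (\<Sum>k<L. of_nat (e k) * w (Q k))"
  by (simp add: key_monomial_def w_prod w_power Q_nz)

text \<open>In a \<open>Q\<^sub>L\<close>-adic expansion with at most \<open>mb L\<close> terms the nonzero summands have distinct
  values, by minimality of \<open>mb L\<close>; the least one gives the initial form. By induction \<open>g\<close>
  preserves the value of every summand, hence that of the sum.\<close>

lemma initial_form:
  assumes "1 \<le> L" "f \<noteq> 0" "degree f < d L"
    and "fst g \<noteq> 0" "snd g \<noteq> 0" "\<And>l. \<exists>c. act g (Q l) = smult [:c:] (Q l)"
  shows "\<exists>e c. c \<noteq> 0 \<and> w f = (\<Sum>k<L. of_nat (e k) * w (Q k)) \<and>
      above (w f) (f - smult [:c:] (key_monomial L e)) \<and> w (act g f) = w f"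
  using assms(1,2,3)
proof (induction L arbitrary: f rule: nat_induct_at_least)
  case base
  then have "degree f = 0" using d_1 by simp
  then obtain p where f: "f = [:p:]" by (auto elim: degree_eq_zeroE)
  \<comment> \<open>Degree 0 in Y leaves a polynomial in X alone. Its value is decided by the lowest
    power of X that occurs, and the recursion on the coefficients counts that power in
    \<open>e 0\<close>.\<close>
  have "\<exists>(e :: nat \<Rightarrow> nat) c. c \<noteq> 0 \<and> w [:p:] = of_nat (e 0) * w (Q 0) \<and>
      above (w [:p:]) ([:p:] - smult [:c:] (Q 0 ^ e 0)) \<and> w (act g [:p:]) = w [:p:]" 
    if "p \<noteq> 0" for p
    using that
  proof (induction p)
    case (pCons a p)
    have X: "[:pCons a p:] = [:[:a:]:] + varX * [:p:]" by (simp add: varX_def)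
    have Xnz: "varX \<noteq> (0 :: 'k poly poly)" by (simp add: varX_def)
    have actX: "act g [:pCons a p:] = [:[:a:]:] + smult [:fst g:] varX * act g [:p:]"
      unfolding X by (simp only: act_add act_mult act_varX act_const)
    show ?case
    proof (cases "a = 0")
      case False
      have ab: "above 0 (varX * h)" for h
        using w_mult[OF Xnz, of h] w_varX w_nonneg[of h] by (cases "h = 0") (auto simp: above_def)
      have 1: "w [:pCons a p:] = 0"
        using w_add_above(2)[of "[:[:a:]:]" "varX * [:p:]"] ab[of "[:p:]"] False w_const[OF False]
        by (simp add: X)
      have "above 0 (smult [:fst g:] varX * act g [:p:])"
        unfolding mult_smult_left by (intro above_smult ab)
      then have 2: "w (act g [:pCons a p:]) = 0"
        unfolding actX using w_add_above(2)[of "[:[:a:]:]" "smult [:fst g:] varX * act g [:p:]"] False w_const[OF False]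
        by simp
      have 3: "[:pCons a p:] - smult [:a:] (Q 0 ^ 0) = varX * [:p:]"
        by (simp add: X one_pCons)
      show ?thesis
      proof (intro exI conjI)
        show "w [:pCons a p:] = of_nat ((\<lambda>_. 0 :: nat) (0 :: nat)) * w (Q 0)" using 1 by simp
        show "above (w [:pCons a p:]) ([:pCons a p:] - smult [:a:] (Q 0 ^ (\<lambda>_. 0) (0 :: nat)))"
          unfolding 1 3 by (rule ab)
        show "w (act g [:pCons a p:]) = w [:pCons a p:]" unfolding 1 2 ..
      qed (rule False)
    next
      case True
      then have p: "p \<noteq> 0" using pCons by auto
      then obtain e :: "nat \<Rightarrow> nat" and c where e: "c \<noteq> 0" "w [:p:] = of_nat (e 0) * w (Q 0)"
        "above (w [:p:]) ([:p:] - smult [:c:] (Q 0 ^ e 0))" "w (act g [:p:]) = w [:p:]"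
        using pCons by blast
      have X': "[:pCons a p:] = [:p:] * varX" using X True by simp
      have 1: "w [:pCons a p:] = w [:p:] + w varX"
        unfolding X' using p Xnz by (intro w_mult) auto
      have "[:pCons a p:] - smult [:c:] (Q 0 ^ Suc (e 0)) = ([:p:] - smult [:c:] (Q 0 ^ e 0)) * varX"
        by (simp add: X' Q_0 algebra_simps)
      then have 2: "above (w [:pCons a p:]) ([:pCons a p:] - smult [:c:] (Q 0 ^ Suc (e 0)))"
        using above_mult[OF e(3) Xnz] by (simp add: 1)
      have "w (act g [:pCons a p:]) = w (smult [:fst g:] (varX * act g [:p:]))"
        unfolding actX by (simp add: True)
      also have "\<dots> = w [:pCons a p:]"
        using assms(4,5) p Xnz by (simp add: w_smult w_mult act_eq_0_iff 1 e(4))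
      finally show ?thesis
        using e 1 2 Q_0 by (intro exI[of _ "\<lambda>_. Suc (e 0)"] exI[of _ c]) (simp add: algebra_simps)
    qed
  qed simp
  from this[of p] show ?case using base(1) by (simp add: f key_monomial_def)
next
  case (Suc L)
  let ?q = "Q L" and ?M = "mb L"
  have "lead_coeff ?q = 1" "0 < degree ?q" "degree f < ?M * degree ?q"
    using Suc lead_coeff_Q d_pos d_Suc by (auto simp: d_def)
  from monic_base_expansion[OF this] obtain h where
    f: "f = (\<Sum>s<?M. h s * ?q ^ s)" and h: "\<forall>s<?M. degree (h s) < d L"
    by (auto simp: d_def)
  define S where "S = {s. s < ?M \<and> h s \<noteq> 0}"
  have fS: "f = (\<Sum>s\<in>S. h s * ?q ^ s)"
    unfolding f by (rule sum.mono_neutral_right) (auto simp: S_def)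
  have fin: "finite S" by (simp add: S_def)
  have ne: "S \<noteq> {}" using fS Suc.prems(1) by auto
  have IH: "\<exists>e c. c \<noteq> 0 \<and> w (h s) = (\<Sum>k<L. of_nat (e k) * w (Q k)) \<and>
      above (w (h s)) (h s - smult [:c:] (key_monomial L e)) \<and> w (act g (h s)) = w (h s)" if "s \<in> S" for s
    using Suc.IH[of "h s"] h that by (auto simp: S_def)
  define v where "v s = w (h s) + of_nat s * w ?q" for s
  have wv: "w (h s * ?q ^ s) = v s" if "s \<in> S" for s
    using that by (simp add: v_def S_def w_mult w_power Q_nz)
  have v_ne: "v s \<noteq> v s'" if ss: "s \<in> S" "s' \<in> S" "s < s'" for s s'
  proof
    assume eq: "v s = v s'"
    obtain e e' where "w (h s) = (\<Sum>k<L. of_nat (e k) * w (Q k))" "w (h s') = (\<Sum>k<L. of_nat (e' k) * w (Q k))"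
      using IH[OF ss(1)] IH[OF ss(2)] by blast
    \<comment> \<open>Equal values of two summands would put a multiple of w(Q_L) smaller than
      \<open>mb L\<close> into the group generated by the earlier values; the exponent differences
      may be negative.\<close>
    then have "of_nat (s' - s) * w ?q = (\<Sum>k<L. of_int (int (e k) - int (e' k)) * w (Q k))"
      using eq that by (simp add: v_def of_nat_diff algebra_simps sum_subtractf)
    moreover have "s' - s < ?M" "0 < s' - s" using that by (auto simp: S_def)
    ultimately show False using mb_least[of L "s' - s" "\<lambda>k. int (e k) - int (e' k)"] Suc.hyps by blast
  qed
  define s where "s = arg_min_on v S"
  have s: "s \<in> S" "\<And>s'. s' \<in> S \<Longrightarrow> v s \<le> v s'"
    using arg_min_if_finite(1)[OF fin ne] arg_min_least[OF fin ne] by (auto simp: s_def)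
  have vless: "v s < v s'" if "s' \<in> S" "s' \<noteq> s" for s'
    using s(2)[OF that(1)] v_ne[of s s'] v_ne[of s' s] that s(1) by (cases "s < s'") auto
  have ws: "w (h s * ?q ^ s) = v s" using wv s by simp
  have snz: "h s * ?q ^ s \<noteq> 0" using s by (simp add: S_def Q_nz)
  have dom: "above (v s) (f - h s * ?q ^ s)" "w f = v s"
    using dominant_term[of S s "\<lambda>s. h s * ?q ^ s", OF fin s(1) snz] vless wv fS
    by (auto simp: above_def ws)
  obtain e c where e: "c \<noteq> 0" "w (h s) = (\<Sum>k<L. of_nat (e k) * w (Q k))"
    "above (w (h s)) (h s - smult [:c:] (key_monomial L e))"
    using IH[OF s(1)] by blast
  \<comment> \<open>The index of the summand of least value becomes the exponent of Q_L.\<close>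
  define e' where "e' = e(L := s)"
  have mono: "key_monomial (Suc L) e' = key_monomial L e * ?q ^ s"
    unfolding key_monomial_def e'_def by simp
  have we: "w f = (\<Sum>k<Suc L. of_nat (e' k) * w (Q k))"
    by (simp add: dom(2) v_def e(2) e'_def)
  have "above (v s) ((h s - smult [:c:] (key_monomial L e)) * ?q ^ s)"
    using above_mult[OF e(3), of "?q ^ s"] by (simp add: v_def w_power Q_nz)
  from above_add[OF dom(1) this] have ab: "above (w f) (f - smult [:c:] (key_monomial (Suc L) e'))"
    by (simp add: mono dom(2) algebra_simps)
  obtain \<chi> where \<chi>: "act g ?q = smult [:\<chi>:] ?q" using assms(6) by blast
  have \<chi>0: "\<chi> \<noteq> 0"
    using act_eq_0_iff[OF assms(4,5), of ?q] \<chi> Q_nz[of L] by auto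
  have act_s: "act g (h s * ?q ^ s) = smult [:\<chi> ^ s:] (act g (h s) * ?q ^ s)" for s
    by (simp add: act_mult act_power \<chi> smult_power poly_const_pow)
  have w_act: "w (act g (h s * ?q ^ s)) = v s" if "s \<in> S" for s
  proof -
    have "w (act g (h s)) = w (h s)" using IH[OF that] by blast
    then show ?thesis
      using that \<chi>0 assms(4,5) unfolding act_s
      by (simp add: w_smult w_mult act_eq_0_iff Q_nz S_def w_power v_def)
  qed
  have "act g f = (\<Sum>s\<in>S. act g (h s * ?q ^ s))"
    by (simp add: fS act_sum)
  moreover have "act g (h s * ?q ^ s) \<noteq> 0"
    using snz assms(4,5) by (simp add: act_eq_0_iff)
  \<comment> \<open>Each summand keeps its value under g, so the images have the same distinct
    values and the same index dominates.\<close>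
  ultimately have "w (act g f) = v s"
    using dominant_term(3)[of S s "\<lambda>s. act g (h s * ?q ^ s)", OF fin s(1)] vless w_act s(1)
    by (auto simp: above_def)
  then show ?case using e(1) we ab dom(2) by metis
qed

end

section \<open>Finite generation for rational values\<close>

lemma common_denominator:
  fixes S :: "rat set"
  assumes "finite S"
  shows "\<exists>D::nat. 0 < D \<and> (\<forall>r\<in>S. of_nat D * r \<in> \<int>)"
  using assms
proof induction
  case (insert r S)
  then obtain D :: nat where D: "0 < D" "\<forall>r\<in>S. of_nat D * r \<in> \<int>" by blast
  obtain a b where ab: "r = of_int a / of_int b" "0 < b"
    by (metis Fract_of_int_quotient Rat_cases)
  have "of_nat (nat b * D) * r = of_nat D * of_int a"
    using ab by (simp add: field_simps)
  then have "of_nat (nat b * D) * r \<in> \<int>" by (metis Ints_mult Ints_of_int Ints_of_nat)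
  moreover have "of_nat (nat b * D) * y \<in> \<int>" if "y \<in> S" for y
  proof -
    have "of_nat (nat b) * (of_nat D * y) \<in> \<int>" using D(2) that by (metis Ints_mult Ints_of_nat)
    then show ?thesis by (simp add: mult.assoc)
  qed
  ultimately show ?case using D ab(2) by (intro exI[of _ "nat b * D"]) auto
qed (auto intro: exI[of _ 1])

lemma act_one: "act (1, 1) f = f"
  by (intro poly_eqI) (simp add: coeff_act)

section \<open>Unbounded degrees of the key polynomials from non discreteness\<close>

context rational_generating_sequence
begin

text \<open>The identity (1, 1) of the torus serves as g in \<open>initial_form\<close>: every
  polynomial is an eigenfunction for it, so no eigenfunction hypothesis on Q has to be made
  here.\<close>

lemma value_form:
  assumes "1 \<le> L" "f \<noteq> 0" "degree f < d L"
  shows "\<exists>e. w f = (\<Sum>k<L. of_nat (e k) * w (Q k))"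
proof -
  have "\<exists>c. act (1, 1) (Q l) = smult [:c:] (Q l)" for l
    by (intro exI[of _ 1]) (simp add: act_one flip: one_pCons)
  then show ?thesis
    using initial_form[OF assms, of "(1, 1)"] by auto
qed

text \<open>If \<open>mb\<close> were eventually 1, each later w(Q_l) would be a natural combination
  of earlier ones, so finitely many values would determine a common denominator D of all of them.
  Strictly increasing values in a fixed lattice tend to infinity, and reducing f modulo a Q_l of
  large value puts w f into the same lattice, against \<open>dense\<close>.\<close>

lemma mb_greater_one_cofinal: "\<exists>l\<ge>L. 1 < mb l"
proof (rule ccontr)
  assume neg: "\<not> ?thesis"
  define L0 where "L0 = max 1 L"
  have L0: "1 \<le> L0" by (simp add: L0_def)
  have mb1: "mb l = 1" if "L0 \<le> l" for l
  proof -
    have "\<not> 1 < mb l" "0 < mb l" using neg mb_pos[of l] that by (auto simp: L0_def)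
    then show ?thesis by simp
  qed
  obtain D :: nat where D: "0 < D" "\<forall>r\<in>(\<lambda>k. w (Q k)) ` {..<L0}. of_nat D * r \<in> \<int>"
    using common_denominator[of "(\<lambda>k. w (Q k)) ` {..<L0}"] by blast
  have sum_Ints: "of_nat D * (\<Sum>k<l. of_nat (e k) * w (Q k)) \<in> \<int>"
    if "\<And>k. k < l \<Longrightarrow> of_nat D * w (Q k) \<in> \<int>" for l and e :: "nat \<Rightarrow> nat"
  proof -
    have "of_nat D * (\<Sum>k<l. of_nat (e k) * w (Q k)) = (\<Sum>k<l. of_nat (e k) * (of_nat D * w (Q k)))"
      by (simp add: sum_distrib_left mult_ac)
    also have "\<dots> \<in> \<int>" by (rule Ints_sum, rule Ints_mult[OF Ints_of_nat], rule that) simp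
    finally show ?thesis .
  qed
  have DQ: "of_nat D * w (Q k) \<in> \<int>" for k
  proof (induction k rule: less_induct)
    case (less k)
    show ?case
    proof (cases "k < L0")
      case False
      then obtain c where "of_nat (mb k) * w (Q k) = (\<Sum>j<k. of_nat (c j) * w (Q j))"
        using Q_step[of k] L0 by auto
      then have "w (Q k) = (\<Sum>j<k. of_nat (c j) * w (Q j))" using mb1 False by simp
      then show ?thesis using sum_Ints[of k c] less by simp
    qed (use D in blast)
  qed
  \<comment> \<open>The numbers D w(Q_l) are integers here, so each strict increase is at least
    1.\<close>
  have grow: "of_nat i \<le> of_nat D * w (Q (L0 + i))" for i
  proof (induction i)
    case 0
    then show ?case using w_Q_pos[of L0] by simp
  next
    case (Suc i)
    have "of_nat D * w (Q (L0 + i)) < of_nat D * w (Q (L0 + Suc i))"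
      using w_Q_Suc[of "L0 + i"] L0 D by simp
    moreover obtain a b where "of_nat D * w (Q (L0 + i)) = of_int a" "of_nat D * w (Q (L0 + Suc i)) = of_int b"
      using DQ Ints_cases by metis
    ultimately show ?case using Suc by simp
  qed
  obtain f where f: "f \<noteq> 0" "of_nat D * w f \<notin> \<int>" using dense D by blast
  obtain i :: nat where i: "of_nat D * w f < of_nat i" using reals_Archimedean2 by blast
  define l where "l = L0 + i"
  have l: "1 \<le> l" "w f < w (Q l)"
    using i grow[of i] D L0 by (auto simp: l_def dest: order_less_le_trans)
  \<comment> \<open>The multiple of Q_l has value above w f, so the remainder has the value of f;
    its degree is small enough for \<open>value_form\<close>.\<close>
  obtain u r where ur: "pseudo_divmod f (Q l) = (u, r)" by fastforce
  have fu: "f = Q l * u + r"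
    using pseudo_divmod(1)[OF Q_nz ur] lead_coeff_Q[OF l(1)] by simp
  have r: "degree r < d l"
    using pseudo_divmod(2)[OF Q_nz ur] d_pos[OF l(1)] by (auto simp: d_def)
  have "above (w f) (- (Q l * u))"
    using l w_nonneg[of u] by (intro above_uminus) (cases "u = 0"; auto simp: above_def w_mult Q_nz)
  from w_add_above[OF f(1) this] have "r \<noteq> 0" "w r = w f"
    using fu by simp_all
  with value_form[OF l(1) _ r] obtain e where "w f = (\<Sum>k<l. of_nat (e k) * w (Q k))" by auto
  then have "of_nat D * w f \<in> \<int>" using sum_Ints DQ by simp
  with f show False by simp
qed

lemma d_unbounded: "\<exists>L\<ge>1. n < d L"
proof (induction n)
  case 0
  show ?case using d_1 by (intro exI[of _ 1]) simp
next
  case (Suc n)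
  then obtain L where L: "1 \<le> L" "n < d L" by blast
  obtain l where l: "L \<le> l" "1 < mb l" using mb_greater_one_cofinal by blast
  have "d l < d (Suc l)" using d_Suc[of l] d_pos[of l] L l by simp
  moreover have "d L \<le> d l" using d_mono L l by simp
  ultimately show ?case using L l by (intro exI[of _ "Suc l"]) simp
qed

end

section \<open>Characters of the key polynomials and the criterion for rational values;
  \<open>M\<close> is an exponent annihilating the group\<close>

locale eigen_generating_sequence = rational_generating_sequence w Q mb
  for w :: "'k::field poly poly \<Rightarrow> rat" and Q mb +
  fixes H :: "('k \<times> 'k) set" and M :: nat
  assumes eigen: "eigenfunction H (Q l)"
    and M_pos: "0 < M" and torsion: "g \<in> H \<Longrightarrow> fst g ^ M = 1 \<and> snd g ^ M = 1"
begin

lemma H_nz: "g \<in> H \<Longrightarrow> fst g \<noteq> 0 \<and> snd g \<noteq> 0"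
  using torsion[of g] M_pos by (auto simp: power_0_left)

lemma act_Q:
  assumes "g \<in> H" "1 \<le> l"
  shows "act g (Q l) = smult [:snd g ^ d l:] (Q l)"
proof -
  obtain c where c: "act g (Q l) = smult [:c:] (Q l)"
    using eigen assms by (auto simp: eigenfunction_def)
  then show ?thesis using eigenvalue_monic[OF c] lead_coeff_Q[OF assms(2)] by (simp add: d_def)
qed

lemma Q_invariant_iff:
  assumes "1 \<le> l"
  shows "Q l \<in> invariants H \<longleftrightarrow> (\<forall>g\<in>H. snd g ^ d l = 1)"
proof -
  have "smult [:c:] (Q l) = Q l \<longleftrightarrow> c = 1" for c
  proof
    assume "smult [:c:] (Q l) = Q l"
    then have "coeff (smult [:c:] (Q l)) (degree (Q l)) = coeff (Q l) (degree (Q l))" by simp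
    then show "c = 1" using lead_coeff_Q[OF assms] by (simp add: one_pCons)
  qed (simp flip: one_pCons)
  then show ?thesis using act_Q assms by (auto simp: invariants_def)
qed

lemma Q_invariant_persists:
  assumes "1 \<le> N" "Q N \<in> invariants H" "N \<le> r"
  shows "Q r \<in> invariants H"
proof -
  obtain b where "d r = d N * b" using d_dvd[OF assms(1,3)] by (auto elim: dvdE)
  then show ?thesis using assms by (simp add: Q_invariant_iff power_mult)
qed

lemma act_Q_power_M:
  assumes "g \<in> H" "M dvd e"
  shows "act g (Q k ^ e) = Q k ^ e"
proof -
  obtain c where c: "act g (Q k) = smult [:c:] (Q k)" "c ^ M = 1"
  proof (cases "k = 0")
    \<comment> \<open>\<open>Q 0\<close> is X, not monic of positive degree in Y, so its eigenvalue
      is \<open>fst g\<close> and not a power of \<open>snd g\<close>.\<close>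
    case True
    then show ?thesis using that[of "fst g"] act_varX[of g] torsion[OF assms(1)] by (simp add: Q_0 True)
  next
    case False
    have "(snd g ^ d k) ^ M = (snd g ^ M) ^ d k" by (simp add: mult.commute flip: power_mult)
    then show ?thesis
      using that[of "snd g ^ d k"] act_Q[OF assms(1), of k] torsion[OF assms(1)] False by simp
  qed
  obtain b where "e = M * b" using assms(2) by blast
  then have "c ^ e = 1" using c(2) by (simp add: power_mult)
  then show ?thesis by (simp add: act_power c(1) smult_power poly_const_pow flip: one_pCons)
qed

text \<open>The initial form of \<open>a\<close> is a monomial in the Q_k, and comparing values
  leaves only Q_L itself. The difference from c Q_L has larger value, hence cannot affect the
  character, which must agree with the trivial character of \<open>a\<close>.\<close>

lemma invariant_of_value:
  assumes L: "1 \<le> L" "1 < mb L"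
    and a: "a \<in> invariants H" "a \<noteq> 0"
    and eq: "w (Q L) = (\<Sum>k<L. of_nat (b k) * w (Q k)) + w a"
  shows "Q L \<in> invariants H"
proof -
  have "act g (Q L) = Q L" if g: "g \<in> H" for g
  proof -
    note gnz = H_nz[OF g, THEN conjunct1] H_nz[OF g, THEN conjunct2]
    have eig: "\<exists>c. act g (Q l) = smult [:c:] (Q l)" for l
      using eigen g by (auto simp: eigenfunction_def)
    obtain R' where R': "1 \<le> R'" "degree a < d R'" using d_unbounded by blast
    \<comment> \<open>The level must exceed L as well as accommodate the degree of \<open>a\<close>,
      so that Q_L is among the factors of the initial monomial.\<close>
    define R where "R = max R' (Suc L)"
    have R: "1 \<le> R" "L < R" "degree a < d R"
      using R' d_mono[of R' R] by (auto simp: R_def)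
    obtain e c where e: "c \<noteq> 0" "w a = (\<Sum>k<R. of_nat (e k) * w (Q k))"
      "above (w a) (a - smult [:c:] (key_monomial R e))"
      using initial_form[OF R(1) a(2) R(3) gnz eig] by blast
    have b_nonneg: "0 \<le> (\<Sum>k<L. of_nat (b k) * w (Q k))"
      using w_Q_pos by (intro sum_nonneg mult_nonneg_nonneg) (auto simp: less_imp_le)
    have term_nonneg: "0 \<le> of_nat (e k) * w (Q k)" for k
      using w_Q_pos[of k] by simp
    have le: "w a \<le> w (Q L)" using eq b_nonneg by simp
    have e_large: "e k = 0" if "L < k" "k < R" for k
    proof (rule ccontr)
      assume "e k \<noteq> 0"
      then have "1 * w (Q k) \<le> of_nat (e k) * w (Q k)"
        using w_Q_pos[of k] by (intro mult_right_mono) auto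
      also have "\<dots> \<le> w a"
        unfolding e(2) using that term_nonneg by (intro member_le_sum) auto
      finally show False using le w_Q_strict_mono[OF L(1) that(1)] by simp
    qed
    have "(\<Sum>k<R. of_nat (e k) * w (Q k)) = (\<Sum>k<Suc L. of_nat (e k) * w (Q k))"
      using R(2) e_large by (intro sum.mono_neutral_right) auto
    then have wa: "w a = (\<Sum>k<L. of_nat (e k) * w (Q k)) + of_nat (e L) * w (Q L)"
      using e(2) by simp
    \<comment> \<open>Without Q_L in the monomial, 1 times w(Q_L) would be a combination of the
      earlier values, although \<open>mb L\<close> exceeds 1.\<close>
    have eL: "e L \<noteq> 0"
    proof
      assume "e L = 0"
      then have "of_nat 1 * w (Q L) = (\<Sum>k<L. of_int (int (b k + e k)) * w (Q k))"
        using eq wa by (simp add: sum.distrib algebra_simps)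
      then show False using mb_least[OF L(1) zero_less_one L(2), of "\<lambda>k. int (b k + e k)"] by blast
    qed
    \<comment> \<open>One factor Q_L already uses up the bound w a \<le> w(Q_L), and every further
      factor has positive value.\<close>
    have e_small: "e k = 0" if "k < L" for k
    proof (rule ccontr)
      assume "e k \<noteq> 0"
      then have "0 < of_nat (e k) * w (Q k)" using w_Q_pos[of k] by simp
      also have "\<dots> \<le> (\<Sum>k<L. of_nat (e k) * w (Q k))"
        using that term_nonneg by (intro member_le_sum) auto
      finally have "of_nat (e L) * w (Q L) < w a" using wa by simp
      moreover have "1 * w (Q L) \<le> of_nat (e L) * w (Q L)"
        using eL w_Q_pos[of L] by (intro mult_right_mono) auto
      ultimately show False using le by simp
    qed
    have "w a = of_nat (e L) * w (Q L)" using wa e_small by simp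
    then have "of_nat (e L) * w (Q L) \<le> 1 * w (Q L)" using le by simp
    then have "e L \<le> 1" using w_Q_pos[of L] by (simp add: mult_le_cancel_right)
    then have eL1: "e L = 1" using eL by simp
    have "key_monomial R e = (\<Prod>k\<in>{L}. Q k ^ e k)"
      unfolding key_monomial_def
    proof (rule prod.mono_neutral_right)
      show "\<forall>k\<in>{..<R} - {L}. Q k ^ e k = 1"
        using e_small e_large by (metis DiffE insertI1 lessThan_iff linorder_neqE_nat power_0)
    qed (use R(2) in auto)
    then have mono: "key_monomial R e = Q L" using eL1 by simp
    have waL: "w a = w (Q L)" using wa e_small eL1 by simp
    define h where "h = a - smult [:c:] (Q L)"
    have h: "above (w a) h" using e(3) by (simp add: h_def mono)
    have act_h: "above (w a) (act g h)"
    proof (cases "h = 0")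
      case False
      obtain R'' where "1 \<le> R''" "degree h < d R''" using d_unbounded by blast
      then have "w (act g h) = w h"
        using initial_form[OF _ False _ gnz eig] by blast
      then show ?thesis using h False by (simp add: above_def)
    qed simp
    obtain \<chi> where \<chi>: "act g (Q L) = smult [:\<chi>:] (Q L)" using eig by blast
    have "act g a = a" using a(1) g by (simp add: invariants_def)
    then have "act g h = a - smult [:c:] (smult [:\<chi>:] (Q L))"
      by (simp add: h_def act_diff act_smult \<chi> del: smult_smult)
    \<comment> \<open>The Q_L parts cancel, leaving a multiple of \<open>a\<close> whose value is
      strictly above w a; this is possible only for the multiple 0.\<close>
    then have "act g h - smult [:\<chi>:] h = smult [:1 - \<chi>:] a"
      by (simp add: h_def smult_diff_right mult.commute smult_diff_left[of "[:1:]" "[:\<chi>:]" a, simplified] flip: one_pCons)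
    then have "above (w a) (smult [:1 - \<chi>:] a)"
      using above_diff[OF act_h above_smult[OF h, of \<chi>]] by simp
    then have "\<chi> = 1"
      using w_smult[of "1 - \<chi>" a] a(2) by (cases "\<chi> = 1") (auto simp: above_def)
    then show ?thesis using \<chi> by (simp flip: one_pCons)
  qed
  then show ?thesis by (simp add: invariants_def)
qed

theorem finitely_generated_iff:
  "finitely_generated_over (w ` (- {0})) (w ` (invariants H - {0})) \<longleftrightarrow>
     (\<exists>N>0. \<forall>r\<ge>N. Q r \<in> invariants H)"
proof
  assume "finitely_generated_over (w ` (- {0})) (w ` (invariants H - {0}))"
  then obtain F where F: "finite F" "F \<subseteq> w ` (- {0})"
    "w ` (- {0}) = {s + u |s u. s \<in> F \<and> u \<in> w ` (invariants H - {0})}"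
    unfolding finitely_generated_over_def by blast
  obtain P where P: "P \<subseteq> - {0}" "finite P" "F = w ` P"
    using finite_subset_image[OF F(1,2)] by blast
  \<comment> \<open>The sum bounds the degree of every chosen representative of F, so one level L
    serves whichever representative occurs for Q_L.\<close>
  define D where "D = (\<Sum>p\<in>P. degree p)"
  obtain L0 where L0: "1 \<le> L0" "D < d L0" using d_unbounded by blast
  obtain L where L: "L0 \<le> L" "1 < mb L" using mb_greater_one_cofinal by blast
  have "w (Q L) \<in> w ` (- {0})" using Q_nz by simp
  then obtain p a where pa: "w (Q L) = w p + w a" "p \<in> P" "a \<in> invariants H" "a \<noteq> 0"
    unfolding F(3) P(3) by blast
  have "degree p \<le> D" unfolding D_def using P(2) pa(2) by (intro member_le_sum) auto
  also have "\<dots> < d L" using L0 L d_mono[of L0 L] by simp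
  finally obtain b where "w p = (\<Sum>k<L. of_nat (b k) * w (Q k))"
    using value_form[of L p] pa(2) P(1) L0 L by auto
  then have "Q L \<in> invariants H"
    using invariant_of_value[of L a b] pa L0 L by auto
  then show "\<exists>N>0. \<forall>r\<ge>N. Q r \<in> invariants H"
    using Q_invariant_persists[of L] L0 L by (intro exI[of _ L]) auto
next
  assume "\<exists>N>0. \<forall>r\<ge>N. Q r \<in> invariants H"
  then obtain N where N: "0 < N" "\<And>r. N \<le> r \<Longrightarrow> Q r \<in> invariants H" by blast
  \<comment> \<open>Values of the monomials in Q_0, ..., Q_(N-1) with exponents below M. The
    extensional function space makes the set of exponent vectors finite.\<close>
  define F where "F = (\<lambda>e. w (key_monomial N e)) ` PiE {..<N} (\<lambda>_. {..<M})"
  have "w f \<in> {s + u |s u. s \<in> F \<and> u \<in> w ` (invariants H - {0})}" if "f \<noteq> 0" for f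
  proof -
    obtain L' where L': "1 \<le> L'" "degree f < d L'" using d_unbounded by blast
    define L where "L = max L' N"
    have L: "1 \<le> L" "N \<le> L" "degree f < d L"
      using L' d_mono[of L' L] by (auto simp: L_def)
    obtain e where e: "w f = (\<Sum>k<L. of_nat (e k) * w (Q k))"
      using value_form[OF L(1) \<open>f \<noteq> 0\<close> L(3)] by blast
    define e1 where "e1 = (\<lambda>k\<in>{..<N}. e k mod M)"
    \<comment> \<open>Exponents below place N are split by division by M. The remainders
      \<open>e1\<close> give an element of F; \<open>e2\<close> keeps M-th powers and the invariant
      Q_k with k \<ge> N, hence an invariant monomial.\<close>
    define e2 where "e2 k = (if k < N then M * (e k div M) else e k)" for k
    have "w f = (\<Sum>k<L. (if k < N then of_nat (e k mod M) * w (Q k) else 0) + of_nat (e2 k) * w (Q k))"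
      unfolding e
    proof (rule sum.cong[OF refl])
      fix k
      have "e k = M * (e k div M) + e k mod M" by simp
      then have "of_nat (e k) = (of_nat (M * (e k div M)) + of_nat (e k mod M) :: rat)"
        by (metis of_nat_add)
      then show "of_nat (e k) * w (Q k)
        = (if k < N then of_nat (e k mod M) * w (Q k) else 0) + of_nat (e2 k) * w (Q k)"
        by (simp add: e2_def algebra_simps)
    qed
    also have "\<dots> = (\<Sum>k<L. if k < N then of_nat (e k mod M) * w (Q k) else 0) + w (key_monomial L e2)"
      by (simp add: sum.distrib w_key_monomial)
    also have "(\<Sum>k<L. if k < N then of_nat (e k mod M) * w (Q k) else 0)
        = (\<Sum>k<N. of_nat (e k mod M) * w (Q k))"
      using L(2) by (intro sum.mono_neutral_cong_right) auto
    also have "\<dots> = w (key_monomial N e1)" by (simp add: w_key_monomial e1_def)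
    finally have "w f = w (key_monomial N e1) + w (key_monomial L e2)" .
    moreover have "e1 \<in> PiE {..<N} (\<lambda>_. {..<M})"
      using M_pos by (auto simp: e1_def)
    moreover have "act g (Q k ^ e2 k) = Q k ^ e2 k" if "g \<in> H" for g k
      using act_Q_power_M[OF that, of "e2 k" k] N(2)[of k] that
      by (cases "k < N") (auto simp: e2_def invariants_def act_power)
    then have "key_monomial L e2 \<in> invariants H"
      by (simp add: invariants_def key_monomial_def act_prod)
    ultimately show ?thesis using key_monomial_nonzero[of L e2] unfolding F_def by blast
  qed
  \<comment> \<open>The inclusion of F + T in S: the product realizes the sum of values.\<close>
  moreover have "w p + w a \<in> w ` (- {0})" if "p \<noteq> 0" "a \<noteq> 0" for p a
    using that w_mult[OF that] by (intro image_eqI[of _ _ "p * a"]) auto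
  moreover have "finite F" unfolding F_def by (intro finite_imageI finite_PiE) auto
  moreover have "F \<subseteq> w ` (- {0})" using key_monomial_nonzero by (auto simp: F_def)
  ultimately show "finitely_generated_over (w ` (- {0})) (w ` (invariants H - {0}))"
    unfolding finitely_generated_over_def
    by (intro exI[of _ F] conjI) (auto simp: F_def key_monomial_nonzero)
qed

end

section \<open>Rank one groups as ordered subgroups of the rationals\<close>

lemma comm_group_additive: "comm_group (additive_group_on (UNIV :: 'g::ab_group_add set))"
proof (rule comm_groupI)
  fix x :: 'g
  show "\<exists>y\<in>carrier (additive_group_on UNIV). y \<otimes>\<^bsub>additive_group_on UNIV\<^esub> x = \<one>\<^bsub>additive_group_on UNIV\<^esub>"
    by (simp add: additive_group_on_def exI[of _ "- x"])
qed (simp_all add: additive_group_on_def algebra_simps)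

lemma zmult_add_left: "zmult (a + b) x = zmult a x + zmult b x"
  and zmult_add_right: "zmult a (x + y) = zmult a x + zmult a y"
  and zmult_0 [simp]: "zmult 0 x = 0"
  and zmult_1 [simp]: "zmult 1 x = x"
proof -
  interpret comm_group "additive_group_on (UNIV :: 'a set)" by (rule comm_group_additive)
  note u = zmult_def additive_group_on_def
  show "zmult (a + b) x = zmult a x + zmult b x"
    using int_pow_mult[of x a b] by (simp add: u)
  show "zmult a (x + y) = zmult a x + zmult a y"
    using int_pow_distrib[of x y a] by (simp add: u)
  show "zmult 0 x = 0"
    using int_pow_0[of "additive_group_on (UNIV :: 'a set)" x] by (simp add: u)
  show "zmult 1 x = x"
    using int_pow_1[of x] by (simp add: u)
qed

lemma zmult_0_right [simp]: "zmult a 0 = 0"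
  using zmult_add_right[of a 0 0] by simp

lemma zmult_uminus_left: "zmult (- a) x = - zmult a x"
  using zmult_add_left[of "- a" a x] by (simp add: eq_neg_iff_add_eq_0)

lemma zmult_uminus_right: "zmult a (- x) = - zmult a x"
  using zmult_add_right[of a "- x" x] by (simp add: eq_neg_iff_add_eq_0)

lemma zmult_pos:
  fixes x :: "'g::linordered_ab_group_add"
  assumes "0 < a" "0 < x"
  shows "0 < zmult a x"
proof -
  have "0 < zmult (int (Suc k)) x" for k
  proof (induction k)
    case (Suc k)
    then show ?case
      using add_pos_pos[OF assms(2) Suc] zmult_add_left[of 1 "int (Suc k)" x] by simp
  qed (use assms in simp)
  from this[of "nat a - 1"] assms(1) show ?thesis by simp
qed

lemma zmult_pos_iff:
  fixes x :: "'g::linordered_ab_group_add"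
  assumes "0 < x"
  shows "0 < zmult a x \<longleftrightarrow> 0 < a"
proof
  assume "0 < zmult a x"
  then show "0 < a"
    using zmult_pos[of "- a" x] assms by (cases a "0 :: int" rule: linorder_cases) (auto simp: zmult_uminus_left)
qed (use zmult_pos assms in blast)

text \<open>A linearly ordered group is torsion-free: a nonzero multiple of a positive element has a
  definite sign.\<close>

lemma zmult_eq_0_iff:
  fixes x :: "'g::linordered_ab_group_add"
  shows "zmult a x = 0 \<longleftrightarrow> a = 0 \<or> x = 0"
proof -
  have pos: "zmult a y \<noteq> 0" if "0 < y" "a \<noteq> 0" for y :: 'g
    using that zmult_pos[of a y] zmult_pos[of "- a" y]
    by (cases a "0 :: int" rule: linorder_cases) (auto simp: zmult_uminus_left)
  show ?thesis
    using pos[of x] pos[of "- x"] by (cases x "0 :: 'g" rule: linorder_cases) (auto simp: zmult_uminus_right)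
qed

locale additive_subgroup_of =
  fixes \<Phi> :: "'g::linordered_ab_group_add set"
  assumes zero: "0 \<in> \<Phi>" and add: "a \<in> \<Phi> \<Longrightarrow> b \<in> \<Phi> \<Longrightarrow> a + b \<in> \<Phi>"
    and uminus: "a \<in> \<Phi> \<Longrightarrow> - a \<in> \<Phi>"
begin

lemma diff: "a \<in> \<Phi> \<Longrightarrow> b \<in> \<Phi> \<Longrightarrow> a - b \<in> \<Phi>"
  using add[of a "- b"] uminus[of b] by simp

lemma zmult_closed: "a \<in> \<Phi> \<Longrightarrow> zmult z a \<in> \<Phi>"
proof (induction z rule: int_induct[where k = 0])
  case (step1 i)
  then show ?case using add zmult_add_left[of i 1 a] by simp
next
  case (step2 i)
  then show ?case using diff[of "zmult (i - 1) a + a" a] zmult_add_left[of "i - 1" 1 a] by simp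
qed (simp add: zero)

lemma sum_closed: "(\<And>i. i \<in> I \<Longrightarrow> f i \<in> \<Phi>) \<Longrightarrow> (\<Sum>i\<in>I. f i) \<in> \<Phi>"
  by (induction I rule: infinite_finite_induct) (auto simp: zero add)

text \<open>An element of the relation subgroup involves finitely many rationals. For a common
  denominator \<open>D\<close> of them, \<open>a \<otimes> q \<mapsto> (D q) a\<close> is additive on the relations involved.\<close>

lemma tensor_one_nonzero:
  assumes a: "a \<in> \<Phi>"
    and gen: "frag_of (a, 1) \<in> generate (free_Abelian_group (\<Phi> \<times> UNIV)) (tensor_relations \<Phi>)"
  shows "a = 0"
proof -
  let ?F = "free_Abelian_group (\<Phi> \<times> (UNIV :: rat set))"
  let ?G = "additive_group_on (UNIV :: 'g set)"
  interpret G: comm_group ?G by (rule comm_group_additive)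
  \<comment> \<open>On a free group the generators may be sent anywhere, and the floor makes the
    prescription total. It is additive in \<open>b\<close> always, but in \<open>q\<close> only
    where D clears the denominators.\<close>
  have "\<exists>\<phi>. \<phi> \<in> hom ?F ?G \<and> (\<forall>b\<in>\<Phi>. \<forall>q. \<phi> (frag_of (b, q)) = zmult \<lfloor>of_nat D * q\<rfloor> b)" for D :: nat
  proof -
    obtain \<phi> where "\<phi> \<in> hom ?F ?G"
      "\<And>p. p \<in> \<Phi> \<times> UNIV \<Longrightarrow> \<phi> (frag_of p) = (\<lambda>(b, q). zmult \<lfloor>of_nat D * q\<rfloor> b) p"
      using G.free_Abelian_group_universal[of "\<lambda>(b, q). zmult \<lfloor>of_nat D * q\<rfloor> b" "\<Phi> \<times> (UNIV :: rat set)"]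
      by (auto simp: additive_group_on_def)
    then show ?thesis by (intro exI[of _ \<phi>]) auto
  qed
  then obtain \<phi> where \<phi>: "\<And>D. \<phi> D \<in> hom ?F ?G"
    "\<And>D b q. b \<in> \<Phi> \<Longrightarrow> \<phi> D (frag_of (b, q)) = zmult \<lfloor>of_nat D * q\<rfloor> b"
    by metis
  have carr: "frag_of (b, q) \<in> carrier ?F \<longleftrightarrow> b \<in> \<Phi>" for b and q :: rat by simp
  have hom_add: "\<phi> D (y + z) = \<phi> D y + \<phi> D z" if "y \<in> carrier ?F" "z \<in> carrier ?F" for D y z
    using hom_mult[OF \<phi>(1)[of D] that] by (simp add: additive_group_on_def)
  have hom_diff: "\<phi> D (y - z) = \<phi> D y - \<phi> D z" if "y \<in> carrier ?F" "z \<in> carrier ?F" for D y z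
  proof -
    have "y - z \<in> carrier ?F" using that keys_diff[of y z] by auto
    from hom_add[OF this that(2), of D] show ?thesis by simp
  qed
  have sub: "tensor_relations \<Phi> \<subseteq> carrier ?F"
    unfolding tensor_relations_def using add
    by (auto dest!: subsetD[OF keys_diff])
  \<comment> \<open>Demanding vanishing for every positive multiple of a threshold, and not just for
    one D, allows thresholds of different relations to be combined.\<close>
  have rel: "\<exists>D>0. \<forall>D'>0. D dvd D' \<longrightarrow> \<phi> D' z = 0" if "z \<in> tensor_relations \<Phi>" for z
  proof -
    from that consider
      b c q where "z = frag_of (b + c, q) - frag_of (b, q) - frag_of (c, q)" "b \<in> \<Phi>" "c \<in> \<Phi>"
    | b q r where "z = frag_of (b, q + r) - frag_of (b, q) - frag_of (b, r)" "b \<in> \<Phi>"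
      by (auto simp: tensor_relations_def)
    then show ?thesis
    proof cases
      case 1
      have cl: "frag_of (b + c, q) - frag_of (b, q) \<in> carrier ?F"
        using 1 add by (auto dest!: subsetD[OF keys_diff])
      have "\<phi> D' z = 0" for D'
        unfolding 1(1) using hom_diff[OF cl, of "frag_of (c, q)"]
          hom_diff[of "frag_of (b + c, q)" "frag_of (b, q)"] 1 add
        by (simp add: \<phi>(2) zmult_add_right)
      then show ?thesis by auto
    next
      case 2
      obtain D :: nat where D: "0 < D" "of_nat D * q \<in> \<int>" "of_nat D * r \<in> \<int>"
        using common_denominator[of "{q, r}"] by auto
      have cl: "frag_of (b, q + r) - frag_of (b, q) \<in> carrier ?F"
        using 2 by (auto dest!: subsetD[OF keys_diff])
      have "\<phi> D' z = 0" if "D dvd D'" for D'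
      proof -
        obtain k where "D' = D * k" using \<open>D dvd D'\<close> by (auto elim: dvdE)
        then have "of_nat D' * y = of_nat k * (of_nat D * y)" for y :: rat by simp
        then have "of_nat D' * q \<in> \<int>" "of_nat D' * r \<in> \<int>"
          using D by (metis Ints_mult Ints_of_nat)+
        then obtain u v where uv: "of_nat D' * q = of_int u" "of_nat D' * r = of_int v"
          by (metis Ints_cases)
        then have "of_nat D' * (q + r) = of_int (u + v)" by (simp add: algebra_simps)
        then show ?thesis
          unfolding 2(1) using hom_diff[OF cl, of "frag_of (b, r)"]
            hom_diff[of "frag_of (b, q + r)" "frag_of (b, q)"] 2 uv
          by (simp only: \<phi>(2) carr floor_of_int zmult_add_left) simp
      qed
      then show ?thesis using D(1) by auto
    qed
  qed
  have "\<exists>D>0. \<forall>D'>0. D dvd D' \<longrightarrow> \<phi> D' z = 0"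
    if "z \<in> generate ?F (tensor_relations \<Phi>)" for z
    using that
  proof (induction z rule: generate.induct)
    case one
    have "\<phi> D' 0 = 0" for D' using hom_add[of 0 0 D'] by simp
    then show ?case by auto
  next
    case (incl h)
    then show ?case using rel by blast
  next
    case (inv h)
    have "\<phi> D' (- h) = - \<phi> D' h" for D'
      using hom_diff[of 0 h D'] hom_add[of 0 0 D'] sub inv by auto
    moreover have "inv\<^bsub>?F\<^esub> h = - h" 
      using subsetD[OF sub inv] by (simp only: carrier_free_Abelian_group_iff inv_free_Abelian_group)
    ultimately show ?case using rel[OF inv] by simp
  next
    case (eng y z)
    then obtain D D2 where D: "0 < D" "\<And>D'. 0 < D' \<Longrightarrow> D dvd D' \<Longrightarrow> \<phi> D' y = 0"
      "0 < D2" "\<And>D'. 0 < D' \<Longrightarrow> D2 dvd D' \<Longrightarrow> \<phi> D' z = 0" by meson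
    have "y \<in> carrier ?F" "z \<in> carrier ?F"
      using eng(1,2) group.generate_in_carrier[OF group_free_Abelian_group sub] by blast+
    \<comment> \<open>The product of the two thresholds is a threshold for both factors.\<close>
    then have "\<phi> D' (y \<otimes>\<^bsub>?F\<^esub> z) = 0" if "0 < D'" "D * D2 dvd D'" for D'
      using hom_add[of y z D'] D that by (auto dest: dvd_mult_left dvd_mult_right)
    then show ?case using D(1,3) by (intro exI[of _ "D * D2"]) auto
  qed
  \<comment> \<open>The map for D sends a \<otimes> 1 to D a, which vanishes only for a = 0 by
    torsion-freeness.\<close>
  from this[OF gen] obtain D where "0 < D" "\<phi> D (frag_of (a, 1)) = 0" by auto
  then show ?thesis using \<phi>(2)[OF a, of D 1] by (simp add: zmult_eq_0_iff)
qed

text \<open>The map is a \<mapsto> a \<otimes> 1 followed by the given isomorphism; injectivity is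
  \<open>tensor_one_nonzero\<close>. Compatibility with the order is not yet available, since the
  isomorphism knows only the group structure.\<close>

lemma tensor_rat_embedding:
  assumes "tensor_rat \<Phi> \<cong> additive_group_on (UNIV :: rat set)"
  obtains \<tau> :: "'g \<Rightarrow> rat" where
    "\<And>a b. a \<in> \<Phi> \<Longrightarrow> b \<in> \<Phi> \<Longrightarrow> \<tau> (a + b) = \<tau> a + \<tau> b"
    "\<And>a. a \<in> \<Phi> \<Longrightarrow> \<tau> a = 0 \<Longrightarrow> a = 0"
proof -
  let ?F = "free_Abelian_group (\<Phi> \<times> (UNIV :: rat set))"
  let ?N = "generate ?F (tensor_relations \<Phi>)"
  let ?R = "additive_group_on (UNIV :: rat set)"
  interpret F: comm_group ?F by (rule abelian_free_Abelian_group)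
  interpret R: comm_group ?R by (rule comm_group_additive)
  have sub: "tensor_relations \<Phi> \<subseteq> carrier ?F"
    unfolding tensor_relations_def using add
    by (auto dest!: subsetD[OF keys_diff])
  have N: "subgroup ?N ?F" by (rule F.generate_is_subgroup[OF sub])
  interpret N: normal ?N ?F by (rule F.subgroup_imp_normal[OF N])
  obtain h where h: "h \<in> iso (?F Mod ?N) ?R"
    using assms by (auto simp: is_iso_def tensor_rat_def)
  have hh: "h \<in> hom (?F Mod ?N) ?R" and inj: "inj_on h (carrier (?F Mod ?N))"
    using h by (auto simp: iso_def bij_betw_def)
  define \<psi> where "\<psi> z = h (?N #>\<^bsub>?F\<^esub> z)" for z
  have \<psi>_hom: "\<psi> \<in> hom ?F ?R"
    unfolding \<psi>_def using hom_compose[OF N.r_coset_hom_Mod hh] by (simp add: o_def)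
  have \<psi>_add: "\<psi> (y + z) = \<psi> y + \<psi> z" if "y \<in> carrier ?F" "z \<in> carrier ?F" for y z
    using hom_mult[OF \<psi>_hom that] by (simp add: additive_group_on_def)
  have N_one: "h ?N = 0"
    using hom_one[OF hh N.factorgroup_is_group R.is_group] by (simp add: FactGroup_def additive_group_on_def)
  have \<psi>_N: "\<psi> z = 0" if "z \<in> ?N" for z
    using F.coset_join2[OF N.mem_carrier[OF that] N that] N_one by (simp add: \<psi>_def)
  \<comment> \<open>An injective map on the quotient makes the relation subgroup the whole
    kernel.\<close>
  have N_\<psi>: "z \<in> ?N" if "z \<in> carrier ?F" "\<psi> z = 0" for z
  proof -
    have "?N #>\<^bsub>?F\<^esub> z \<in> carrier (?F Mod ?N)" "?N \<in> carrier (?F Mod ?N)"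
      using that(1) N.subgroup_in_rcosets[OF F.is_group] by (auto simp: FactGroup_def RCOSETS_def)
    with inj have "?N #>\<^bsub>?F\<^esub> z = ?N" using that(2) N_one by (auto simp: \<psi>_def inj_on_def)
    then show ?thesis using F.coset_join1[OF _ that(1) N] by blast
  qed
  show ?thesis
  proof (rule that[of "\<lambda>a. \<psi> (frag_of (a, 1))"])
    fix a b assume ab: "a \<in> \<Phi>" "b \<in> \<Phi>"
    let ?r = "frag_of (a + b, 1) - frag_of (a, 1) - frag_of (b, 1) :: ('g \<times> rat) \<Rightarrow>\<^sub>0 int"
    have r: "?r \<in> tensor_relations \<Phi>" using ab unfolding tensor_relations_def by blast
    have cl: "frag_of (a, 1) + frag_of (b, 1) \<in> carrier ?F"
      using ab by (auto dest!: subsetD[OF keys_add])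
    have "\<psi> (frag_of (a + b, 1)) = \<psi> (?r + (frag_of (a, 1) + frag_of (b, 1)))" by simp
    also have "\<dots> = \<psi> ?r + \<psi> (frag_of (a, 1) + frag_of (b, 1))"
      by (rule \<psi>_add[OF subsetD[OF sub r] cl])
    also have "\<dots> = \<psi> (frag_of (a, 1)) + \<psi> (frag_of (b, 1))"
      using \<psi>_N[OF generate.incl[OF r]] \<psi>_add[of "frag_of (a, 1)" "frag_of (b, 1)"] ab by simp
    finally show "\<psi> (frag_of (a + b, 1)) = \<psi> (frag_of (a, 1)) + \<psi> (frag_of (b, 1))" .
  next
    fix a assume "a \<in> \<Phi>" "\<psi> (frag_of (a, 1)) = 0"
    then show "a = 0" using tensor_one_nonzero N_\<psi>[of "frag_of (a, 1)"] by simp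
  qed
qed

end

section \<open>Additive and order preserving maps from the value group to the rationals\<close>

locale additive_on = additive_subgroup_of \<Phi>
  for \<Phi> :: "'g::linordered_ab_group_add set" +
  fixes \<rho> :: "'g \<Rightarrow> rat"
  assumes map_add: "a \<in> \<Phi> \<Longrightarrow> b \<in> \<Phi> \<Longrightarrow> \<rho> (a + b) = \<rho> a + \<rho> b"
begin

lemma map_0: "\<rho> 0 = 0"
  using map_add[OF zero zero] by simp

lemma map_diff: "a \<in> \<Phi> \<Longrightarrow> b \<in> \<Phi> \<Longrightarrow> \<rho> (a - b) = \<rho> a - \<rho> b"
  using map_add[OF diff, of a b b] by simp

lemma map_zmult: "a \<in> \<Phi> \<Longrightarrow> \<rho> (zmult z a) = of_int z * \<rho> a"
proof (induction z rule: int_induct[where k = 0])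
  case base
  then show ?case by (simp add: map_0)
next
  case (step1 i)
  then show ?case
    using map_add[OF zmult_closed[OF step1(3), of i] step1(3)] zmult_add_left[of i 1 a]
    by (simp add: algebra_simps)
next
  case (step2 i)
  have "zmult (i - 1) a = zmult i a - a"
    using zmult_add_left[of "i - 1" 1 a] by simp
  then show ?case using step2 map_diff[OF zmult_closed[OF step2(3), of i] step2(3)]
    by (simp add: left_diff_distrib)
qed

lemma map_sum: "(\<And>i. i \<in> I \<Longrightarrow> f i \<in> \<Phi>) \<Longrightarrow> \<rho> (\<Sum>i\<in>I. f i) = (\<Sum>i\<in>I. \<rho> (f i))"
  by (induction I rule: infinite_finite_induct) (auto simp: map_0 map_add sum_closed)

end

text \<open>An additive injection may reverse signs, so it is normalized to take the value 1 at the
  positive element \<open>a0\<close>. Any positive a then satisfies q a = p a0 with q > 0, and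
  comparing signs in the ordered group gives p > 0.\<close>

lemma (in additive_subgroup_of) rational_rank_one_embedding:
  assumes "tensor_rat \<Phi> \<cong> additive_group_on (UNIV :: rat set)" "a0 \<in> \<Phi>" "0 < a0"
  obtains \<rho> where "additive_on \<Phi> \<rho>" "\<And>a. a \<in> \<Phi> \<Longrightarrow> 0 < a \<Longrightarrow> 0 < \<rho> a"
proof -
  obtain \<tau> :: "'g \<Rightarrow> rat" where \<tau>: "\<And>a b. a \<in> \<Phi> \<Longrightarrow> b \<in> \<Phi> \<Longrightarrow> \<tau> (a + b) = \<tau> a + \<tau> b"
    "\<And>a. a \<in> \<Phi> \<Longrightarrow> \<tau> a = 0 \<Longrightarrow> a = 0"
    using tensor_rat_embedding[OF assms(1)] by blast
  interpret \<tau>: additive_on \<Phi> \<tau> by unfold_locales (rule \<tau>(1))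
  have t0: "\<tau> a0 \<noteq> 0" using \<tau>(2) assms by force
  show ?thesis
  proof (rule that[of "\<lambda>a. \<tau> a / \<tau> a0"])
    show "additive_on \<Phi> (\<lambda>a. \<tau> a / \<tau> a0)"
      by unfold_locales (simp add: \<tau>(1) add_divide_distrib)
    fix a assume a: "a \<in> \<Phi>" "0 < a"
    obtain p q where pq: "\<tau> a / \<tau> a0 = of_int p / of_int q" "0 < q"
      by (metis Fract_of_int_quotient Rat_cases)
    then have "of_int q * \<tau> a = of_int p * \<tau> a0" using t0 by (simp add: field_simps)
    then have "\<tau> (zmult q a - zmult p a0) = 0"
      using a assms by (simp add: \<tau>.map_diff \<tau>.map_zmult zmult_closed)
    then have "zmult q a - zmult p a0 = 0"
      by (rule \<tau>(2)[OF diff[OF zmult_closed[OF a(1)] zmult_closed[OF assms(2)]]])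
    then have "0 < zmult p a0" using zmult_pos[OF pq(2) a(2)] by simp
    then have "0 < p" using zmult_pos_iff[OF assms(3)] by simp
    then show "0 < \<tau> a / \<tau> a0" using pq by simp
  qed
qed

locale ordered_embedding = additive_on +
  assumes map_pos: "a \<in> \<Phi> \<Longrightarrow> 0 < a \<Longrightarrow> 0 < \<rho> a"
begin

lemma map_less_iff: "a \<in> \<Phi> \<Longrightarrow> b \<in> \<Phi> \<Longrightarrow> \<rho> a < \<rho> b \<longleftrightarrow> a < b"
  using map_pos[OF diff, of b a] map_pos[OF diff, of a b] map_diff[of a b] map_diff[of b a]
  by (cases a b rule: linorder_cases) auto

lemma map_eq_iff: "a \<in> \<Phi> \<Longrightarrow> b \<in> \<Phi> \<Longrightarrow> \<rho> a = \<rho> b \<longleftrightarrow> a = b"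
  using map_less_iff[of a b] map_less_iff[of b a] by (cases a b rule: linorder_cases) auto

lemma map_le_iff: "a \<in> \<Phi> \<Longrightarrow> b \<in> \<Phi> \<Longrightarrow> \<rho> a \<le> \<rho> b \<longleftrightarrow> a \<le> b"
  using map_less_iff[of b a] by (simp add: not_less[symmetric])

text \<open>Since \<rho> is injective on \<Phi> and all sums stay in \<Phi>, a generating set can be
  pushed forward and pulled back; finite generation may thus be decided on rational values.\<close>

lemma finitely_generated_over_image:
  assumes "S \<subseteq> \<Phi>" "T \<subseteq> \<Phi>"
  shows "finitely_generated_over (\<rho> ` S) (\<rho> ` T) \<longleftrightarrow> finitely_generated_over S T"
proof -
  have inj: "inj_on \<rho> \<Phi>" using map_eq_iff by (auto simp: inj_on_def)
  have image: "\<rho> ` {s + u |s u. s \<in> F \<and> u \<in> T} = {s + u |s u. s \<in> \<rho> ` F \<and> u \<in> \<rho> ` T}"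
    if "F \<subseteq> \<Phi>" for F
  proof -
    have "\<rho> (s + u) = \<rho> s + \<rho> u" if "s \<in> F" "u \<in> T" for s u
      using that \<open>F \<subseteq> \<Phi>\<close> assms(2) by (intro map_add) auto
    then show ?thesis by (auto 4 4 simp: image_iff)
  qed
  have sums: "{s + u |s u. s \<in> F \<and> u \<in> T} \<subseteq> \<Phi>" if "F \<subseteq> \<Phi>" for F
    using that assms(2) add by auto
  have iff: "\<rho> ` S = {s + u |s u. s \<in> \<rho> ` F \<and> u \<in> \<rho> ` T} \<longleftrightarrow> S = {s + u |s u. s \<in> F \<and> u \<in> T}"
    if "F \<subseteq> S" for F
  proof -
    have F: "F \<subseteq> \<Phi>" using that assms(1) by blast
    show ?thesis
      unfolding image[OF F, symmetric] by (rule inj_on_image_eq_iff[OF inj assms(1) sums[OF F]])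
  qed
  show ?thesis
  proof
    assume "finitely_generated_over (\<rho> ` S) (\<rho> ` T)"
    then obtain F' where F': "finite F'" "F' \<subseteq> \<rho> ` S" "\<rho> ` S = {s + u |s u. s \<in> F' \<and> u \<in> \<rho> ` T}"
      unfolding finitely_generated_over_def by blast
    obtain F where F: "F \<subseteq> S" "finite F" "F' = \<rho> ` F"
      using finite_subset_image[OF F'(1,2)] by blast
    have "S = {s + u |s u. s \<in> F \<and> u \<in> T}"
      using iff[OF F(1)] F'(3)[unfolded F(3)] by (rule iffD1)
    then show "finitely_generated_over S T"
      unfolding finitely_generated_over_def using F(1,2) by (intro exI[of _ F]) auto
  next
    assume "finitely_generated_over S T"
    then obtain F where F: "finite F" "F \<subseteq> S" "S = {s + u |s u. s \<in> F \<and> u \<in> T}"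
      unfolding finitely_generated_over_def by blast
    have "\<rho> ` S = {s + u |s u. s \<in> \<rho> ` F \<and> u \<in> \<rho> ` T}"
      using iff[OF F(2)] F(3) by (rule iffD2)
    then show "finitely_generated_over (\<rho> ` S) (\<rho> ` T)"
      unfolding finitely_generated_over_def using finite_imageI[OF F(1)] image_mono[OF F(2)]
      by (intro exI[of _ "\<rho> ` F"] conjI)
  qed
qed

text \<open>D \<rho> embeds \<Phi> as a nonzero subgroup of the integers, that is n times the
  integers for its least positive member n, and division by n gives the isomorphism.\<close>

lemma bounded_denominators_imp_discrete:
  assumes "0 < D" "\<And>a. a \<in> \<Phi> \<Longrightarrow> of_nat D * \<rho> a \<in> \<int>" "a0 \<in> \<Phi>" "0 < a0"
  shows "additive_group_on \<Phi> \<cong> integer_group"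
proof -
  \<comment> \<open>The floor only changes the type from \<open>rat\<close> to \<open>int\<close>;
    on \<Phi> it is exact.\<close>
  define \<phi> where "\<phi> a = \<lfloor>of_nat D * \<rho> a\<rfloor>" for a
  have \<phi>: "of_int (\<phi> a) = of_nat D * \<rho> a" if "a \<in> \<Phi>" for a
    using assms(2)[OF that] by (simp add: \<phi>_def)
  have \<phi>_diff: "\<phi> (a - zmult z b) = \<phi> a - z * \<phi> b" if "a \<in> \<Phi>" "b \<in> \<Phi>" for a b z
  proof -
    have "of_int (\<phi> (a - zmult z b)) = (of_int (\<phi> a - z * \<phi> b) :: rat)"
      using that by (simp add: \<phi> map_diff map_zmult zmult_closed diff algebra_simps)
    then show ?thesis by (simp only: of_int_eq_iff)
  qed
  have \<phi>_add: "\<phi> (a + b) = \<phi> a + \<phi> b" if "a \<in> \<Phi>" "b \<in> \<Phi>" for a b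
  proof -
    have "of_int (\<phi> (a + b)) = (of_int (\<phi> a + \<phi> b) :: rat)"
      using that by (simp add: \<phi> map_add add algebra_simps)
    then show ?thesis by (simp only: of_int_eq_iff)
  qed
  have \<phi>_inj: "a = b" if "a \<in> \<Phi>" "b \<in> \<Phi>" "\<phi> a = \<phi> b" for a b
    using \<phi>[OF that(1)] \<phi>[OF that(2)] that map_eq_iff[of a b] assms(1) by simp
  define P where "P k \<longleftrightarrow> 0 < k \<and> (\<exists>a\<in>\<Phi>. \<phi> a = int k)" for k
  have "(of_int (\<phi> a0) :: rat) > 0" using \<phi>[OF assms(3)] map_pos[OF assms(3,4)] assms(1) by simp
  then have "P (nat (\<phi> a0))" using assms(3) by (auto simp: P_def)
  define n where "n = (LEAST k. P k)"
  have "P n" unfolding n_def by (rule LeastI) fact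
  then obtain b where b: "0 < n" "b \<in> \<Phi>" "\<phi> b = int n" by (auto simp: P_def)
  have ndvd: "int n dvd \<phi> a" if "a \<in> \<Phi>" for a
  proof (rule ccontr)
    assume "\<not> int n dvd \<phi> a"
    then have "\<phi> a mod int n \<noteq> 0" by (simp only: dvd_eq_mod_eq_0 not_False_eq_True)
    moreover have "0 \<le> \<phi> a mod int n" using b(1) by simp
    ultimately have pos: "0 < \<phi> a mod int n" by linarith
    \<comment> \<open>Subtracting a multiple of \<open>b\<close> realizes the remainder as a value,
      which would be smaller than n.\<close>
    have "\<phi> (a - zmult (\<phi> a div int n) b) = \<phi> a mod int n"
      using \<phi>_diff[OF that b(2)] b(3) by (simp add: minus_div_mult_eq_mod)
    then have "P (nat (\<phi> a mod int n))"
      using pos diff[OF that zmult_closed[OF b(2)]] by (auto simp: P_def)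
    then have "n \<le> nat (\<phi> a mod int n)" unfolding n_def by (rule Least_le)
    then have "int n \<le> \<phi> a mod int n" using pos by (simp only: le_nat_iff order_less_imp_le)
    moreover have "\<phi> a mod int n < int n" using b(1) by simp
    ultimately show False by linarith
  qed
  define \<psi> where "\<psi> a = \<phi> a div int n" for a
  have \<psi>: "\<phi> a = int n * \<psi> a" if "a \<in> \<Phi>" for a using ndvd[OF that] by (simp add: \<psi>_def)
  have "\<psi> (a + c) = \<psi> a + \<psi> c" if "a \<in> \<Phi>" "c \<in> \<Phi>" for a c
    using \<phi>_add[OF that] ndvd[OF that(1)] by (simp add: \<psi>_def div_plus_div_distrib_dvd_left)
  then have "\<psi> \<in> hom (additive_group_on \<Phi>) integer_group"
    by (intro homI) (auto simp: additive_group_on_def integer_group_def)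
  moreover have "bij_betw \<psi> \<Phi> UNIV"
    unfolding bij_betw_def
  proof
    show "inj_on \<psi> \<Phi>" using \<phi>_inj \<psi> by (auto simp: inj_on_def)
    have "z \<in> \<psi> ` \<Phi>" for z
    proof
      \<comment> \<open>The preimage of z is z times \<open>b\<close>, written as a difference so
        that the formula for differences applies.\<close>
      have "\<phi> (0 - zmult (- z) b) = \<phi> 0 + z * int n" using \<phi>_diff[OF zero b(2), of "- z"] b(3) by simp
      then show "z = \<psi> (0 - zmult (- z) b)" using b(1) by (simp add: \<psi>_def \<phi>_def map_0)
      show "0 - zmult (- z) b \<in> \<Phi>" by (intro diff zero zmult_closed b)
    qed
    then show "\<psi> ` \<Phi> = UNIV" by auto
  qed
  ultimately have "\<psi> \<in> iso (additive_group_on \<Phi>) integer_group"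
    by (simp add: iso_def additive_group_on_def integer_group_def)
  then show ?thesis by (auto simp: is_iso_def)
qed

end

section \<open>The value semigroups of the local rings\<close>

lemma not_in_ideal_XY: "c \<noteq> 0 \<Longrightarrow> [:[:c:]:] \<notin> ideal_XY"
proof
  assume "c \<noteq> 0" "[:[:c:]:] \<in> ideal_XY"
  then obtain f g where "[:[:c:]:] = varX * f + varY * g" by (auto simp: ideal_XY_def)
  then have "coeff (coeff [:[:c:]:] 0) 0 = coeff (coeff (varX * f + varY * g) 0) 0" by simp
  then show False using \<open>c \<noteq> 0\<close> by (simp add: varX_def varY_def coeff_mult)
qed

lemma one_not_in_ideal_XY: "1 \<notin> ideal_XY"
  using not_in_ideal_XY[of 1] by (simp add: one_pCons)

lemma varX_in_ideal_XY: "varX \<in> ideal_XY" and varY_in_ideal_XY: "varY \<in> ideal_XY"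
  and zero_in_ideal_XY: "0 \<in> ideal_XY"
proof -
  have "varX = varX * 1 + varY * 0" "varY = varX * 0 + varY * 1" "0 = varX * 0 + varY * 0"
    by simp_all
  then show "varX \<in> ideal_XY" "varY \<in> ideal_XY" "0 \<in> ideal_XY"
    unfolding ideal_XY_def by blast+
qed

lemma varX_nonzero: "varX \<noteq> 0" and varY_nonzero: "varY \<noteq> 0"
  by (simp_all add: varX_def varY_def)

lemma mult_in_ideal_XY: "f \<in> ideal_XY \<Longrightarrow> f * h \<in> ideal_XY"
proof -
  assume "f \<in> ideal_XY"
  then obtain a b where "f = varX * a + varY * b" by (auto simp: ideal_XY_def)
  then have "f * h = varX * (a * h) + varY * (b * h)" by (simp add: algebra_simps)
  then show ?thesis unfolding ideal_XY_def by blast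
qed

locale dominating_valuation =
  fixes \<nu> :: "'k::field poly poly fract \<Rightarrow> 'g::linordered_ab_group_add"
  assumes val: "valuation \<nu>" and dom: "dominates \<nu> (localization UNIV ideal_XY)"
begin

lemma val_mult: "f \<noteq> 0 \<Longrightarrow> g \<noteq> 0 \<Longrightarrow> \<nu> (f * g) = \<nu> f + \<nu> g"
  using val by (auto simp: valuation_def)

lemma val_add: "f \<noteq> 0 \<Longrightarrow> g \<noteq> 0 \<Longrightarrow> f + g \<noteq> 0 \<Longrightarrow> min (\<nu> f) (\<nu> g) \<le> \<nu> (f + g)"
  using val by (auto simp: valuation_def)

lemma val_1: "\<nu> 1 = 0"
  using val_mult[of 1 1] by simp

lemma val_divide: "f \<noteq> 0 \<Longrightarrow> g \<noteq> 0 \<Longrightarrow> \<nu> (f / g) = \<nu> f - \<nu> g"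
  using val_mult[of "f / g" g] by simp

lemma val_in_value_group: "f \<noteq> 0 \<Longrightarrow> \<nu> f \<in> value_group \<nu>"
  by (simp add: value_group_def)

sublocale additive_subgroup_of "value_group \<nu>"
proof
  show "0 \<in> value_group \<nu>" using val_in_value_group[of 1] val_1 by simp
  fix a b assume "a \<in> value_group \<nu>" "b \<in> value_group \<nu>"
  then obtain f g where "a = \<nu> f" "b = \<nu> g" "f \<noteq> 0" "g \<noteq> 0" by (auto simp: value_group_def)
  then show "a + b \<in> value_group \<nu>" using val_mult[of f g] val_in_value_group[of "f * g"] by simp
next
  fix a assume "a \<in> value_group \<nu>"
  then obtain f where "a = \<nu> f" "f \<noteq> 0" by (auto simp: value_group_def)
  then show "- a \<in> value_group \<nu>" using val_divide[of 1 f] val_1 val_in_value_group[of "1 / f"] by simp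
qed

lemma localization_nonneg: "f \<in> localization UNIV ideal_XY \<Longrightarrow> f \<noteq> 0 \<Longrightarrow> 0 \<le> \<nu> f"
  using dom by (auto simp: dominates_def valuation_ring_def)

lemma to_fract_in_localization: "1 \<in> B \<Longrightarrow> f \<in> B \<Longrightarrow> to_fract f \<in> localization B (ideal_XY \<inter> B)"
  unfolding localization_def to_fract_def using one_not_in_ideal_XY by blast

lemma polynomial_nonneg: "f \<noteq> 0 \<Longrightarrow> 0 \<le> \<nu> (to_fract f)"
  using localization_nonneg[of "to_fract f"] to_fract_in_localization[of UNIV f] by simp

text \<open>Both s and 1/s lie in the local ring, and domination makes both values
  nonnegative.\<close>

lemma val_outside_ideal:
  assumes "s \<notin> ideal_XY"
  shows "\<nu> (to_fract s) = 0"
proof -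
  have s: "s \<noteq> 0" using assms zero_in_ideal_XY by blast
  have "Fract 1 s \<in> localization UNIV ideal_XY" unfolding localization_def using assms by blast
  then have "0 \<le> \<nu> (Fract 1 s)" using s by (intro localization_nonneg) (simp_all add: Fract_conv_to_fract)
  moreover have "\<nu> (Fract 1 s) = - \<nu> (to_fract s)"
    using s val_divide[of 1 "to_fract s"] val_1 by (simp add: Fract_conv_to_fract)
  ultimately show ?thesis using polynomial_nonneg[OF s] by simp
qed

text \<open>With value 0, f would be a unit of the valuation ring but a nonunit of the local ring,
  so the maximal ideals would not match.\<close>

lemma val_in_ideal:
  assumes "f \<in> ideal_XY" "f \<noteq> 0"
  shows "0 < \<nu> (to_fract f)"
proof (rule ccontr)
  assume "\<not> ?thesis"
  then have zero: "\<nu> (to_fract f) = 0" using polynomial_nonneg[OF assms(2)] by simp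
  let ?B = "localization UNIV ideal_XY :: 'k poly poly fract set"
  have "to_fract f \<notin> nonunits (valuation_ring \<nu>)"
  proof -
    have "1 / to_fract f \<in> valuation_ring \<nu>"
      using val_divide[of 1 "to_fract f"] assms(2) val_1 zero by (simp add: valuation_ring_def)
    moreover have "to_fract f * (1 / to_fract f) = 1" using assms(2) by simp
    ultimately show ?thesis unfolding nonunits_def by blast
  qed
  moreover have fB: "to_fract f \<in> ?B" using to_fract_in_localization[of UNIV f] by simp
  moreover have "\<not> (\<exists>g\<in>?B. to_fract f * g = 1)"
  proof
    assume "\<exists>g\<in>?B. to_fract f * g = 1"
    then obtain a s where s: "s \<notin> ideal_XY" "to_fract f * Fract a s = 1" by (auto simp: localization_def)
    then have "s \<noteq> 0" using zero_in_ideal_XY by blast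
    then have "to_fract (f * a) = to_fract s" using s(2) by (simp add: Fract_conv_to_fract field_simps)
    then have "f * a = s" by (simp only: to_fract_eq_iff)
    then show False using s(1) mult_in_ideal_XY[OF assms(1)] by blast
  qed
  ultimately show False using dom unfolding dominates_def nonunits_def by blast
qed

text \<open>Denominators lie outside the ideal and have value 0, so numerators alone decide. It
  serves both for the full ring and for the ring of invariants.\<close>

lemma value_semigroup_localization:
  assumes "1 \<in> B"
  shows "value_semigroup \<nu> (localization B (ideal_XY \<inter> B)) = (\<lambda>f. \<nu> (to_fract f)) ` (B - {0})"
proof (intro equalityI subsetI)
  fix v assume "v \<in> value_semigroup \<nu> (localization B (ideal_XY \<inter> B))"
  then obtain a s where as: "a \<in> B" "s \<in> B" "s \<notin> ideal_XY" "Fract a s \<noteq> 0" "v = \<nu> (Fract a s)"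
    by (auto simp: value_semigroup_def localization_def)
  have "s \<noteq> 0" using as(3) zero_in_ideal_XY by blast
  moreover have "a \<noteq> 0" using as(4) by (auto simp: Fract_conv_to_fract)
  ultimately have "v = \<nu> (to_fract a)"
    using as(5) val_divide[of "to_fract a" "to_fract s"] val_outside_ideal[OF as(3)]
    by (simp add: Fract_conv_to_fract)
  then show "v \<in> (\<lambda>f. \<nu> (to_fract f)) ` (B - {0})" using as(1) \<open>a \<noteq> 0\<close> by blast
next
  fix v assume "v \<in> (\<lambda>f. \<nu> (to_fract f)) ` (B - {0})"
  then obtain f where "f \<in> B" "f \<noteq> 0" "v = \<nu> (to_fract f)" by blast
  then show "v \<in> value_semigroup \<nu> (localization B (ideal_XY \<inter> B))"
    unfolding value_semigroup_def using to_fract_in_localization[OF assms] by auto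
qed

end

text \<open>The first component is a power of \<alpha> and is killed by m, the second a power of
  \<beta> and is killed by n; this supplies the exponent \<open>M\<close> = m n.\<close>

lemma subgroupH_torsion:
  assumes "primitive_root_unity m \<alpha>" "primitive_root_unity n \<beta>" "g \<in> subgroupH \<alpha> \<beta> i j t x"
  shows "fst g ^ (m * n) = 1 \<and> snd g ^ (m * n) = 1"
proof -
  obtain a b where g: "g = (\<alpha> powi a, \<beta> powi b)" using assms(3) by (auto simp: subgroupH_def)
  have "(\<alpha> powi a) ^ (m * n) = (\<alpha> ^ m) powi (int n * a)"
    unfolding power_int_power' power_int_power by (simp add: mult_ac)
  moreover have "(\<beta> powi b) ^ (m * n) = (\<beta> ^ n) powi (int m * b)"
    unfolding power_int_power' power_int_power by (simp add: mult_ac)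
  ultimately show ?thesis using assms(1,2) g by (simp add: primitive_root_unity_def)
qed

section \<open>Passage from the given value group to rational values\<close>

locale generating_sequence_embedding = dominating_valuation \<nu> + ordered_embedding "value_group \<nu>" \<rho>
  for \<nu> :: "'k::field poly poly fract \<Rightarrow> 'g::linordered_ab_group_add" and \<rho> :: "'g \<Rightarrow> rat" +
  fixes Q :: "nat \<Rightarrow> 'k poly poly"
  assumes gen: "generating_sequence \<nu> Q" and nd: "non_discrete \<nu>"
begin

definition w :: "'k poly poly \<Rightarrow> rat" where
  "w f = \<rho> (\<nu> (to_fract f))"

lemma val_poly_in_group: "f \<noteq> 0 \<Longrightarrow> \<nu> (to_fract f) \<in> value_group \<nu>"
  by (rule val_in_value_group) simp

text \<open>Both sides lie in the value group, where \<rho> is injective. Nonvanishing is asked for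
  only up to \<open>l\<close>, because the statement is needed before \<open>Q_nonzero\<close> is
  available.\<close>

lemma relation_iff:
  assumes "\<And>k. k \<le> l \<Longrightarrow> Q k \<noteq> 0"
  shows "zmult q (gen_value \<nu> Q l) = (\<Sum>k<l. zmult (z k) (gen_value \<nu> Q k)) \<longleftrightarrow>
    of_int q * w (Q l) = (\<Sum>k<l. of_int (z k) * w (Q k))"
proof -
  have cl: "gen_value \<nu> Q k \<in> value_group \<nu>" if "k \<le> l" for k
    using assms[OF that] val_poly_in_group by (simp add: gen_value_def)
  have "\<rho> (zmult q (gen_value \<nu> Q l)) = of_int q * w (Q l)"
    using map_zmult[OF cl, of l q] by (simp add: gen_value_def w_def)
  moreover have "\<rho> (\<Sum>k<l. zmult (z k) (gen_value \<nu> Q k)) = (\<Sum>k<l. of_int (z k) * w (Q k))"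
  proof (subst map_sum)
    show "zmult (z k) (gen_value \<nu> Q k) \<in> value_group \<nu>" if "k \<in> {..<l}" for k
      using that by (intro zmult_closed cl) simp
    show "(\<Sum>k<l. \<rho> (zmult (z k) (gen_value \<nu> Q k))) = (\<Sum>k<l. of_int (z k) * w (Q k))"
    proof (rule sum.cong[OF refl])
      fix k assume "k \<in> {..<l}"
      then show "\<rho> (zmult (z k) (gen_value \<nu> Q k)) = of_int (z k) * w (Q k)"
        using map_zmult[OF cl, of k "z k"] by (simp add: gen_value_def w_def)
    qed
  qed
  moreover have "zmult q (gen_value \<nu> Q l) \<in> value_group \<nu>"
    "(\<Sum>k<l. zmult (z k) (gen_value \<nu> Q k)) \<in> value_group \<nu>"
    by (auto intro!: zmult_closed cl sum_closed)
  ultimately show ?thesis using map_eq_iff by metis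
qed

lemma w_mult: "f \<noteq> 0 \<Longrightarrow> g \<noteq> 0 \<Longrightarrow> w (f * g) = w f + w g"
  by (simp add: w_def val_mult map_add val_poly_in_group)

text \<open>The \<open>LEAST\<close> needs a witness: writing w(Q_l) / w(Q_0) as p/q puts q times
  the value of Q_l among the multiples of the value of X.\<close>

lemma mbar_pos:
  assumes "1 \<le> l" "\<And>k. k \<le> l \<Longrightarrow> Q k \<noteq> 0"
  shows "0 < mbar \<nu> Q l"
proof -
  have Q0: "Q 0 = varX" using gen by (simp add: generating_sequence_def)
  have "0 < \<nu> (to_fract (Q 0))"
    using val_in_ideal[OF varX_in_ideal_XY] assms(2)[of 0] by (simp add: Q0)
  then have w0: "0 < w (Q 0)" unfolding w_def using assms(2)[of 0] by (intro map_pos val_poly_in_group) auto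
  obtain p q where pq: "w (Q l) / w (Q 0) = of_int p / of_int q" "0 < q"
    by (metis Fract_of_int_quotient Rat_cases)
  have "of_int q * w (Q l) = of_int p * w (Q 0)" using pq w0 by (simp add: field_simps)
  also have "\<dots> = (\<Sum>k<l. of_int (if k = 0 then p else 0) * w (Q k))"
    using assms(1) by (simp add: if_distrib[of of_int] if_distrib[of "\<lambda>y. y * _"] sum.delta cong: if_cong)
  finally have "zmult q (gen_value \<nu> Q l) = (\<Sum>k<l. zmult (if k = 0 then p else 0) (gen_value \<nu> Q k))"
    using relation_iff[where l = l and q = q and z = "\<lambda>k. if k = 0 then p else 0", OF assms(2)] by simp
  then have "\<exists>q>0. zmult (int q) (gen_value \<nu> Q l) \<in> {\<Sum>k<l. zmult (z k) (gen_value \<nu> Q k) |z. True}"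
    using pq(2) by (intro exI[of _ "nat q"]) auto
  from LeastI_ex[OF this] show ?thesis unfolding mbar_def by blast
qed

lemma Q_steps:
  assumes "1 \<le> l"
  obtains c \<mu> where "\<forall>k. 1 \<le> k \<and> k < l \<longrightarrow> c k < mbar \<nu> Q k"
    "zmult (int (mbar \<nu> Q l)) (gen_value \<nu> Q l) = (\<Sum>k<l. zmult (int (c k)) (gen_value \<nu> Q k))"
    "\<mu> \<noteq> 0" "Q (Suc l) = Q l ^ mbar \<nu> Q l - smult [:\<mu>:] (\<Prod>k<l. Q k ^ c k)"
    "zmult (int (mbar \<nu> Q l)) (gen_value \<nu> Q l) < gen_value \<nu> Q (Suc l)"
  using gen assms unfolding generating_sequence_def by blast

text \<open>Closes the circle between nonvanishing and \<open>mbar_pos\<close>, which is passed on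
  in its conditional form.\<close>

lemma Q_nonzero: "Q l \<noteq> 0"
proof (cases "l = 0")
  case True
  then show ?thesis using gen by (simp add: generating_sequence_def varX_def)
next
  case False
  have "lead_coeff (Q l) = 1 \<and> 1 \<le> degree (Q l) \<and> degree (Q (Suc l)) = mbar \<nu> Q l * degree (Q l)"
  proof (rule key_polynomials_monic[OF mbar_pos])
    show "Q 0 = varX" "Q 1 = varY" using gen by (auto simp: generating_sequence_def)
    show "\<exists>c \<mu>. (\<forall>k. 1 \<le> k \<and> k < l \<longrightarrow> c k < mbar \<nu> Q k) \<and> \<mu> \<noteq> 0 \<and>
      Q (Suc l) = Q l ^ mbar \<nu> Q l - smult [:\<mu>:] (\<Prod>k<l. Q k ^ c k)" if "1 \<le> l" for l
      using Q_steps[OF that] by metis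
  qed (use False in auto)
  then show ?thesis by auto
qed

sublocale rational_generating_sequence w Q "mbar \<nu> Q"
proof
  show "w (f * g) = w f + w g" if "f \<noteq> 0" "g \<noteq> 0" for f g by (rule w_mult[OF that])
  show "min (w f) (w g) \<le> w (f + g)" if "f \<noteq> 0" "g \<noteq> 0" "f + g \<noteq> 0" for f g
  proof -
    have nz: "to_fract f + to_fract g \<noteq> 0" using that(3) by (simp flip: to_fract_add)
    have "min (\<nu> (to_fract f)) (\<nu> (to_fract g)) \<le> \<nu> (to_fract (f + g))"
      using val_add[of "to_fract f" "to_fract g"] that nz by simp
    moreover note val_poly_in_group[OF that(1)] val_poly_in_group[OF that(2)] val_poly_in_group[OF that(3)]
    ultimately show ?thesis
      unfolding w_def by (simp add: min_le_iff_disj map_le_iff del: to_fract_add)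
  qed
  show "w [:[:c:]:] = 0" if "c \<noteq> 0" for c
    using val_outside_ideal[OF not_in_ideal_XY[OF that]] by (simp add: w_def map_0)
  show "0 \<le> w f" if "f \<noteq> 0" for f
    using map_le_iff[OF zero val_poly_in_group[OF that]] polynomial_nonneg[OF that] by (simp add: w_def map_0)
  show "0 < w varX" "0 < w varY"
    unfolding w_def
    by (rule map_pos[OF val_poly_in_group val_in_ideal];
        simp add: varX_in_ideal_XY varY_in_ideal_XY varX_nonzero varY_nonzero)+
  show "0 < mbar \<nu> Q l" if "1 \<le> l" for l by (rule mbar_pos[OF that Q_nonzero])
  show "of_nat q * w (Q l) \<noteq> (\<Sum>k<l. of_int (z k) * w (Q k))"
    if "1 \<le> l" "0 < q" "q < mbar \<nu> Q l" for l q z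
  proof
    assume "of_nat q * w (Q l) = (\<Sum>k<l. of_int (z k) * w (Q k))"
    then have "zmult (int q) (gen_value \<nu> Q l) = (\<Sum>k<l. zmult (z k) (gen_value \<nu> Q k))"
      using relation_iff[where l = l and q = "int q" and z = z, OF Q_nonzero] by simp
    then show False using not_less_Least[OF that(3)[unfolded mbar_def]] that(2) by blast
  qed
  show "Q 0 = varX" "Q 1 = varY" using gen by (auto simp: generating_sequence_def)
  show "\<exists>c \<mu>. (\<forall>k. 1 \<le> k \<and> k < l \<longrightarrow> c k < mbar \<nu> Q k) \<and>
        of_nat (mbar \<nu> Q l) * w (Q l) = (\<Sum>k<l. of_nat (c k) * w (Q k)) \<and> \<mu> \<noteq> 0 \<and>
        Q (Suc l) = Q l ^ mbar \<nu> Q l - smult [:\<mu>:] (\<Prod>k<l. Q k ^ c k) \<and>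
        of_nat (mbar \<nu> Q l) * w (Q l) < w (Q (Suc l))" if l: "1 \<le> l" for l
  proof -
    obtain c \<mu> where c: "\<forall>k. 1 \<le> k \<and> k < l \<longrightarrow> c k < mbar \<nu> Q k"
      "zmult (int (mbar \<nu> Q l)) (gen_value \<nu> Q l) = (\<Sum>k<l. zmult (int (c k)) (gen_value \<nu> Q k))"
      "\<mu> \<noteq> 0" "Q (Suc l) = Q l ^ mbar \<nu> Q l - smult [:\<mu>:] (\<Prod>k<l. Q k ^ c k)"
      "zmult (int (mbar \<nu> Q l)) (gen_value \<nu> Q l) < gen_value \<nu> Q (Suc l)"
      using Q_steps[OF l] by blast
    have cl: "gen_value \<nu> Q k \<in> value_group \<nu>" for k
      using val_poly_in_group[OF Q_nonzero] by (simp add: gen_value_def)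
    have "of_nat (mbar \<nu> Q l) * w (Q l) = (\<Sum>k<l. of_nat (c k) * w (Q k))"
      using relation_iff[where l = l and q = "int (mbar \<nu> Q l)" and z = "\<lambda>k. int (c k)", OF Q_nonzero] c(2) by simp
    moreover have "of_nat (mbar \<nu> Q l) * w (Q l) < w (Q (Suc l))"
      using c(5) map_less_iff[OF zmult_closed[OF cl[of l], of "int (mbar \<nu> Q l)"] cl[of "Suc l"]] map_zmult[OF cl[of l], of "int (mbar \<nu> Q l)"]
      by (simp add: w_def gen_value_def)
    ultimately show ?thesis using c(1,3,4) by blast
  qed
  show "\<exists>f. f \<noteq> 0 \<and> of_nat D * w f \<notin> \<int>" if "0 < D" for D
  proof (rule ccontr)
    assume "\<not> ?thesis"
    then have D: "of_nat D * w f \<in> \<int>" if "f \<noteq> 0" for f using that by blast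
    have "of_nat D * \<rho> a \<in> \<int>" if a: "a \<in> value_group \<nu>" for a
    proof -
      obtain h where h: "h \<noteq> 0" "a = \<nu> h" using a by (auto simp: value_group_def)
      obtain f s where fs: "h = Fract f s" "s \<noteq> 0" by (cases h) auto
      then have f: "f \<noteq> 0" using h(1) by (auto simp: Fract_conv_to_fract)
      \<comment> \<open>Values of fractions are differences of values of polynomials, so a
        denominator D that works for all polynomials works for the whole value group, which would
        then be discrete.\<close>
      have "\<rho> a = w f - w s"
        using fs f h(2) by (simp add: Fract_conv_to_fract val_divide map_diff val_poly_in_group w_def)
      then have "of_nat D * \<rho> a = of_nat D * w f - of_nat D * w s" by (simp add: right_diff_distrib)
      then show ?thesis using D[OF f] D[OF fs(2)] by simp
    qed
    from bounded_denominators_imp_discrete[OF \<open>0 < D\<close> this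
      val_poly_in_group[OF varX_nonzero] val_in_ideal[OF varX_in_ideal_XY varX_nonzero]]
    have "additive_group_on (value_group \<nu>) \<cong> integer_group" .
    then show False using nd by (simp add: non_discrete_def)
  qed
qed

end

theorem proposition0p1:
  fixes \<alpha> \<beta> :: "'k::{alg_closed_field, field_char_0}"
    and m n i j t x :: nat
    and \<nu> :: "'k poly poly fract \<Rightarrow> 'g::linordered_ab_group_add"
    and Q :: "nat \<Rightarrow> 'k poly poly"
    and H :: "('k \<times> 'k) set"
    and A :: "'k poly poly set"
    and S_R S_A :: "'g set"
  assumes "m > 0" and "n > 0"
    and "primitive_root_unity m \<alpha>" and "primitive_root_unity n \<beta>"
    and "admissible m n i j t x"
    and "valuation \<nu>" and "rational_rank_one \<nu>" and "non_discrete \<nu>"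
    and "dominates \<nu> (localization UNIV ideal_XY)"
    and "generating_sequence \<nu> Q"
  defines "H \<equiv> subgroupH \<alpha> \<beta> i j t x"
  defines "A \<equiv> invariants H"
  defines "S_R \<equiv> value_semigroup \<nu> (localization UNIV ideal_XY)"
    and "S_A \<equiv> value_semigroup \<nu> (localization A (ideal_XY \<inter> A))"
  assumes "\<forall>l. eigenfunction H (Q l)"
  shows "(finitely_generated_over S_R S_A \<longleftrightarrow> (\<exists>N>0. \<forall>r\<ge>N. Q r \<in> A)) \<and>
         (\<forall>N\<ge>1. Q N \<in> A \<longrightarrow> (\<forall>M\<ge>N. Q M \<in> A))"
proof -
  interpret dominating_valuation \<nu> by unfold_locales fact+
  have "tensor_rat (value_group \<nu>) \<cong> additive_group_on (UNIV :: rat set)"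
    using \<open>rational_rank_one \<nu>\<close> by (simp add: rational_rank_one_def)
  moreover have "\<nu> (to_fract varX) \<in> value_group \<nu>" by (rule val_in_value_group) (simp add: varX_nonzero)
  moreover have "0 < \<nu> (to_fract varX)" by (rule val_in_ideal[OF varX_in_ideal_XY varX_nonzero])
  ultimately obtain \<rho> where \<rho>: "additive_on (value_group \<nu>) \<rho>"
    "\<And>a. a \<in> value_group \<nu> \<Longrightarrow> 0 < a \<Longrightarrow> 0 < \<rho> a"
    using rational_rank_one_embedding by blast
  interpret additive_on "value_group \<nu>" \<rho> by fact
  interpret generating_sequence_embedding \<nu> \<rho> Q
    by unfold_locales (use \<rho>(2) assms in auto)
  interpret eigen_generating_sequence w Q "mbar \<nu> Q" H "m * n"
  proof
    show "eigenfunction H (Q l)" for l using assms(15) by simp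
    show "0 < m * n" using \<open>m > 0\<close> \<open>n > 0\<close> by simp
    show "fst g ^ (m * n) = 1 \<and> snd g ^ (m * n) = 1" if "g \<in> H" for g
      using subgroupH_torsion assms(3,4) that unfolding H_def by blast
  qed
  \<comment> \<open>Needed to view an invariant polynomial as the fraction with denominator 1 in the
    localization.\<close>
  have "1 \<in> A" by (simp add: A_def invariants_def)
  then have S_A: "S_A = (\<lambda>f. \<nu> (to_fract f)) ` (A - {0})"
    unfolding S_A_def by (rule value_semigroup_localization)
  have S_R: "S_R = (\<lambda>f. \<nu> (to_fract f)) ` (- {0})"
    using value_semigroup_localization[of UNIV] by (simp add: S_R_def Compl_eq_Diff_UNIV)
  have "finitely_generated_over S_R S_A \<longleftrightarrow> finitely_generated_over (\<rho> ` S_R) (\<rho> ` S_A)"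
    unfolding S_R S_A by (rule finitely_generated_over_image[symmetric]) (use val_poly_in_group in auto)
  also have "\<rho> ` S_R = w ` (- {0})" unfolding S_R image_image w_def ..
  also have "\<rho> ` S_A = w ` (invariants H - {0})" unfolding S_A A_def image_image w_def ..
  also note finitely_generated_iff
  finally show ?thesis using Q_invariant_persists unfolding A_def by blast
qed

end
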